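(* Let $B>0$, $\omega_1>0$, $\omega_2>0$ and $\mu>0$, and let $V(x)=\omega_1^2x_1^2+\omega_2^2x_2^2-\mu$ for $x=(x_1,x_2)\in\mathbb{R}^2$. Then $$ \operatorname{Tr}\left( H_B + V \right)_- \leq \frac{B}{2\pi} \sum_{m=0}^\infty \int_{\mathbb{R}^2} \left((2m+1)B + V(x) \right)_- \,dx , $$ where $H_B$ is the Landau Hamiltonian in $L^2(\mathbb{R}^2)$.
   Context: For $B>0$ the Landau Hamiltonian in $L^2(\mathbb{R}^2)$ is the self-adjoint operator $$ H_B=\left(-i\frac{\partial}{\partial x_1} + \frac{Bx_2}{2} \right)^2 + \left(-i\frac{\partial}{\partial x_2} - \frac{Bx_1}{2} \right)^2 . $$ $H_B+V$ is the self-adjoint operator in $L^2(\mathbb{R}^2)$ defined in the sense of quadratic forms. Negative parts: $a_-=\max\{-a,0\}$ for real $a$, and $A_-$ is defined by the functional calculus for a self-adjoint operator $A$; so $\operatorname{Tr}(H_B+V)_-$ is the sum of the absolute values of the negative eigenvalues of $H_B+V$, counted with multiplicity. *)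

theory Defs
  imports "HOL-Analysis.Analysis"
begin

(* The plane is the type real * real; an element of L^2(R^2) is represented by any of its
   Borel measurable representatives, so equality in L^2 is equality almost everywhere. *)

type_synonym plane = "real \<times> real"

definition L2 :: "(plane \<Rightarrow> complex) set" where
  "L2 = {u \<in> borel_measurable borel. integrable lborel (\<lambda>x. (cmod (u x))\<^sup>2)}"

definition L2_inner :: "(plane \<Rightarrow> complex) \<Rightarrow> (plane \<Rightarrow> complex) \<Rightarrow> complex" where
  "L2_inner f g = (\<integral>x. cnj (f x) * g x \<partial>lborel)"

definition locally_integrable :: "(plane \<Rightarrow> complex) \<Rightarrow> bool" where
  "locally_integrable u \<longleftrightarrow> (\<forall>K. compact K \<longrightarrow> set_integrable lborel K u)"

(* D j k is the mixed partial derivative of order j in the first and k in the second variable. *)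
definition smooth :: "(plane \<Rightarrow> complex) \<Rightarrow> bool" where
  "smooth \<phi> \<longleftrightarrow> (\<exists>D :: nat \<Rightarrow> nat \<Rightarrow> plane \<Rightarrow> complex. D 0 0 = \<phi> \<and>
     (\<forall>j k x. (D j k has_derivative
        (\<lambda>h. of_real (fst h) * D (Suc j) k x + of_real (snd h) * D j (Suc k) x)) (at x)))"

definition test_functions :: "(plane \<Rightarrow> complex) set" where
  "test_functions = {\<phi>. smooth \<phi> \<and> compact (closure {x. \<phi> x \<noteq> 0})}"

(* g is the distributional derivative of u in the direction e. *)
definition has_weak_derivative ::
    "plane \<Rightarrow> (plane \<Rightarrow> complex) \<Rightarrow> (plane \<Rightarrow> complex) \<Rightarrow> bool" where
  "has_weak_derivative e u g \<longleftrightarrow> locally_integrable u \<and> locally_integrable g \<and>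
     (\<forall>\<phi>\<in>test_functions.
        (\<integral>x. u x * frechet_derivative \<phi> (at x) e \<partial>lborel) = - (\<integral>x. g x * \<phi> x \<partial>lborel))"

(* Determined only up to a null set, and arbitrary if u has no weak derivative. *)
definition weak_derivative :: "plane \<Rightarrow> (plane \<Rightarrow> complex) \<Rightarrow> plane \<Rightarrow> complex" where
  "weak_derivative e u = (SOME g. has_weak_derivative e u g)"

definition momentum1 :: "real \<Rightarrow> (plane \<Rightarrow> complex) \<Rightarrow> plane \<Rightarrow> complex" where
  "momentum1 B u = (\<lambda>x. - \<i> * weak_derivative (1, 0) u x + of_real (B * snd x / 2) * u x)"

definition momentum2 :: "real \<Rightarrow> (plane \<Rightarrow> complex) \<Rightarrow> plane \<Rightarrow> complex" where
  "momentum2 B u = (\<lambda>x. - \<i> * weak_derivative (0, 1) u x - of_real (B * fst x / 2) * u x)"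

(* The closed quadratic form of the Landau Hamiltonian H_B, on the magnetic Sobolev space of all
   u in L^2 whose distributions momentum1 B u and momentum2 B u belong to L^2. *)
definition landau_form_domain :: "real \<Rightarrow> (plane \<Rightarrow> complex) set" where
  "landau_form_domain B = {u \<in> L2.
     (\<exists>g. has_weak_derivative (1, 0) u g) \<and> (\<exists>g. has_weak_derivative (0, 1) u g) \<and>
     momentum1 B u \<in> L2 \<and> momentum2 B u \<in> L2}"

definition landau_form :: "real \<Rightarrow> (plane \<Rightarrow> complex) \<Rightarrow> (plane \<Rightarrow> complex) \<Rightarrow> complex" where
  "landau_form B v u =
     L2_inner (momentum1 B v) (momentum1 B u) + L2_inner (momentum2 B v) (momentum2 B u)"

definition potential_form_domain :: "(plane \<Rightarrow> real) \<Rightarrow> (plane \<Rightarrow> complex) set" where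
  "potential_form_domain V = {u \<in> L2. integrable lborel (\<lambda>x. \<bar>V x\<bar> * (cmod (u x))\<^sup>2)}"

definition potential_form ::
    "(plane \<Rightarrow> real) \<Rightarrow> (plane \<Rightarrow> complex) \<Rightarrow> (plane \<Rightarrow> complex) \<Rightarrow> complex" where
  "potential_form V v u = (\<integral>x. of_real (V x) * cnj (v x) * u x \<partial>lborel)"

(* Operators in L^2 are represented by their graphs. The operator associated with a form q with
   form domain Q maps u to f iff u lies in Q and q v u = (v, f) for every v in Q. *)
type_synonym L2_operator = "((plane \<Rightarrow> complex) \<times> (plane \<Rightarrow> complex)) set"

definition form_operator ::
    "(plane \<Rightarrow> complex) set \<Rightarrow> ((plane \<Rightarrow> complex) \<Rightarrow> (plane \<Rightarrow> complex) \<Rightarrow> complex) \<Rightarrow> L2_operator" where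
  "form_operator Q q = {(u, f). u \<in> Q \<and> f \<in> L2 \<and> (\<forall>v\<in>Q. q v u = L2_inner v f)}"

(* H_B + V as a form sum; V = 0 gives H_B itself. *)
definition landau_plus_potential :: "real \<Rightarrow> (plane \<Rightarrow> real) \<Rightarrow> L2_operator" where
  "landau_plus_potential B V =
     form_operator (landau_form_domain B \<inter> potential_form_domain V)
       (\<lambda>v u. landau_form B v u + potential_form V v u)"

definition eigenspace :: "L2_operator \<Rightarrow> real \<Rightarrow> (plane \<Rightarrow> complex) set" where
  "eigenspace A l = {u. (u, \<lambda>x. of_real l * u x) \<in> A}"

definition eigenvalue :: "L2_operator \<Rightarrow> real \<Rightarrow> bool" where
  "eigenvalue A l \<longleftrightarrow> (\<exists>u\<in>eigenspace A l. \<not> (AE x in lborel. u x = 0))"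

(* Linear independence over the complex numbers in L^2, i.e. modulo null functions. *)
definition L2_independent :: "nat \<Rightarrow> (nat \<Rightarrow> plane \<Rightarrow> complex) \<Rightarrow> bool" where
  "L2_independent n u \<longleftrightarrow>
     (\<forall>c :: nat \<Rightarrow> complex. (AE x in lborel. (\<Sum>i<n. c i * u i x) = 0) \<longrightarrow> (\<forall>i<n. c i = 0))"

definition L2_dim :: "(plane \<Rightarrow> complex) set \<Rightarrow> enat" where
  "L2_dim E = (SUP n \<in> {n. \<exists>u. (\<forall>i<n. u i \<in> E) \<and> L2_independent n u}. enat n)"

(* For self-adjoint A with discrete negative spectrum this is Tr A_-: the sum of the absolute
   values of the negative eigenvalues, counted with multiplicity (possibly infinite). *)
definition trace_negative_part :: "L2_operator \<Rightarrow> ennreal" where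
  "trace_negative_part A =
     (\<Sum>\<^sub>\<infinity> l \<in> {l. l < 0 \<and> eigenvalue A l}. ennreal \<bar>l\<bar> * ennreal_of_enat (L2_dim (eigenspace A l)))"

definition negative_part :: "real \<Rightarrow> real" where
  "negative_part a = max (- a) 0"

end

theory Submission
  imports Defs "HOL-Probability.Levy" "HOL-Probability.Distributions"
begin

text \<open>
The operator is a pair of uncoupled oscillators in disguise: with \<open>S = sqrt (B\<^sup>2 + (\<omega>\<^sub>1 + \<omega>\<^sub>2)\<^sup>2)\<close>,
\<open>T = sqrt (B\<^sup>2 + (\<omega>\<^sub>1 - \<omega>\<^sub>2)\<^sup>2)\<close> and the normal frequencies \<open>\<alpha> = (S + T) / 2\<close>, \<open>\<beta> = (S - T) / 2\<close>, its
eigenvalues are \<open>(2j + 1) \<alpha> + (2k + 1) \<beta> - \<mu>\<close>, and what matters about the frequencies is only that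
\<open>\<alpha> * \<beta> = \<omega>\<^sub>1 * \<omega>\<^sub>2\<close> and \<open>\<alpha> \<ge> B\<close>.

The inequality is then elementary. The function \<open>max 0\<close> is convex, so by the midpoint rule the sum
over \<open>k\<close> of \<open>max 0 (E - (2k + 1) \<beta>)\<close> is at most \<open>(max 0 E)\<^sup>2 / (4 \<beta>)\<close>. Hence the trace is at most
\<open>\<alpha> / (4 \<omega>\<^sub>1 \<omega>\<^sub>2)\<close> times the sum over \<open>j\<close> of \<open>(max 0 (\<mu> - (2j + 1) \<alpha>))\<^sup>2\<close>. This expression decreases in
\<open>\<alpha>\<close> (lemma \<open>scaled_square_sum_antimono\<close>: its derivative is a sum over the first odd numbers with a
sign that can be read off in closed form), so \<open>\<alpha>\<close> may be replaced by \<open>B\<close>, and the result is exactly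
the right-hand side, because the integral of the negative part of \<open>e + V\<close> equals
\<open>pi (max 0 (\<mu> - e))\<^sup>2 / (2 \<omega>\<^sub>1 \<omega>\<^sub>2)\<close> (lemma \<open>oscillator_sum_le\<close>).

Only an upper bound on the multiplicities of the eigenvalues is needed, and it can be read off from the
weak eigenvalue equation. Let \<open>G\<close> be the Gaussian ground state.
On functions \<open>p * G\<close> with a polynomial \<open>p\<close> the Hamiltonian acts through a second-order operator on
\<open>p\<close> whose first-order part is a linear vector field. Two complex linear forms \<open>X\<close> and \<open>Y\<close> are
eigenvectors of that field, so the states \<open>X^j * Y^k * G\<close> are mapped to
\<open>(2j + 1) \<alpha> + (2k + 1) \<beta> - \<mu>\<close> times themselves plus states of degree \<open>j + k - 2\<close>
(lemma \<open>ham_excited\<close>). Testing the weak eigenvalue equation with these states, and moving all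
derivatives onto them, turns it into a triangular recursion for the coefficients
\<open>M j k = (X^j * Y^k * G, u)\<close> of an eigenfunction \<open>u\<close> (lemma \<open>coefficient_recursion\<close>). If the
coefficients with \<open>(2j + 1) \<alpha> + (2k + 1) \<beta> - \<mu> = l\<close> vanish, then all of them do; so all moments of
\<open>cnj G * u\<close> vanish, and then \<open>u\<close> vanishes because a function with Gaussian decay is determined by its
moments. Therefore the dimension of the eigenspace for \<open>l\<close> is at most the number of such pairs
\<open>(j, k)\<close> (lemma \<open>L2_dim_eigenspace_le\<close>).

The analytic substance is the passage from the distributional form domain to these computations.
The weak derivative in the definition of the form is an arbitrary choice, so it has to be shown
unique up to null sets (lemma \<open>weak_derivative_unique\<close>), which requires enough compactly supported
smooth functions; and the definition of a weak derivative has to be extended from test functions to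
functions \<open>p * G\<close> by a cutoff (lemma \<open>weak_derivative_parts\<close>).
\<close>

section \<open>Midpoint sums and the phase-space integral\<close>

lemma positive_part_square_has_derivative:
  fixes x :: real
  shows "((\<lambda>x. (max 0 x)\<^sup>2) has_real_derivative 2 * max 0 x) (at x)"
proof -
  consider "x > 0" | "x < 0" | "x = 0" by linarith
  then show ?thesis
  proof cases
    case 1
    have "((\<lambda>x. x\<^sup>2) has_real_derivative 2 * x) (at x)"
      by (auto intro!: derivative_eq_intros)
    then have "((\<lambda>x. (max 0 x)\<^sup>2) has_real_derivative 2 * x) (at x)"
      by (rule DERIV_cong_ev[THEN iffD1, rotated -1])
         (use 1 in \<open>auto intro: eventually_mono[OF eventually_gt_at_top] simp: max_def 
            intro!: eventually_nhds_in_open[of "{0<..}", THEN eventually_mono]\<close>)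
    then show ?thesis using 1 by (simp add: max_def)
  next
    case 2
    have "((\<lambda>x. 0) has_real_derivative 0) (at x)"
      by (auto intro!: derivative_eq_intros)
    then have "((\<lambda>x. (max 0 x)\<^sup>2) has_real_derivative 0) (at x)"
      by (rule DERIV_cong_ev[THEN iffD1, rotated -1])
         (use 2 in \<open>auto simp: max_def 
            intro!: eventually_nhds_in_open[of "{..<0}", THEN eventually_mono]\<close>)
    then show ?thesis using 2 by (simp add: max_def)
  next
    case 3
    have "((\<lambda>h. (max 0 h)\<^sup>2 / h) \<longlongrightarrow> 0) (at (0::real))"
    proof (rule Lim_null_comparison)
      show "\<forall>\<^sub>F h in at (0::real). norm ((max 0 h)\<^sup>2 / h) \<le> \<bar>h\<bar>"
        by (auto simp: max_def power2_eq_square intro!: always_eventually)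
      show "((\<lambda>h::real. \<bar>h\<bar>) \<longlongrightarrow> 0) (at 0)"
        by (auto intro!: tendsto_eq_intros)
    qed
    then show ?thesis using 3 by (simp add: DERIV_def)
  qed
qed

text \<open>
This is the midpoint rule for the convex function \<open>max 0\<close>. Peeling off the first term shifts \<open>E\<close> by
\<open>2 * \<beta>\<close>, and the increment of the right-hand side over one step is at least \<open>max 0 (E - \<beta>)\<close>; the
two agree exactly once \<open>E\<close> is at least \<open>2 * \<beta>\<close>.
\<close>
lemma midpoint_sum_le:
  fixes \<beta> E :: real
  assumes "\<beta> > 0"
  shows "(\<Sum>k<K. max 0 (E - (2 * real k + 1) * \<beta>)) \<le> (max 0 E)\<^sup>2 / (4 * \<beta>)"
proof (induction K arbitrary: E)
  case 0
  show ?case using assms by simp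
next
  case (Suc K)
  have "(\<Sum>k<Suc K. max 0 (E - (2 * real k + 1) * \<beta>)) =
      max 0 (E - \<beta>) + (\<Sum>k<K. max 0 ((E - 2 * \<beta>) - (2 * real k + 1) * \<beta>))"
    unfolding sum.lessThan_Suc_shift by (simp add: algebra_simps)
  also have "\<dots> \<le> max 0 (E - \<beta>) + (max 0 (E - 2 * \<beta>))\<^sup>2 / (4 * \<beta>)"
    using Suc.IH by simp
  also have "\<dots> \<le> (max 0 E)\<^sup>2 / (4 * \<beta>)"
  proof -
    have "4 * \<beta> * max 0 (E - \<beta>) + (max 0 (E - 2 * \<beta>))\<^sup>2 \<le> (max 0 E)\<^sup>2"
    proof (cases "E \<ge> 2 * \<beta>")
      case True
      then show ?thesis using assms by (simp add: max_def power2_eq_square algebra_simps)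
    next
      case False
      have "4 * \<beta> * (E - \<beta>) \<le> E\<^sup>2"
        using zero_le_power2[of "E - 2 * \<beta>"] by (simp add: power2_eq_square algebra_simps)
      then show ?thesis using False assms by (auto simp: max_def)
    qed
    then have "(4 * \<beta> * max 0 (E - \<beta>) + (max 0 (E - 2 * \<beta>))\<^sup>2) / (4 * \<beta>) \<le> (max 0 E)\<^sup>2 / (4 * \<beta>)"
      using assms by (intro divide_right_mono) auto
    then show ?thesis using assms by (simp add: add_divide_distrib)
  qed
  finally show ?case .
qed

lemma sum_odd_quadratic:
  "(\<Sum>j<n. (t - (2 * real j + 1)) * (t - 3 * (2 * real j + 1))) = real n * ((t - 2 * real n)\<^sup>2 - 1)"
  by (induction n) (auto simp: power2_eq_square algebra_simps)

text \<open>
This is the heart of the estimate. With \<open>t = \<mu> / s\<close> and \<open>N\<close> the number of active terms,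
the derivative in \<open>s\<close> is \<open>s\<^sup>2\<close> times the sum in \<open>sum_odd_quadratic\<close>, that is
\<open>N * ((t - 2 * N)\<^sup>2 - 1)\<close>, and \<open>t\<close> lies within distance 1 of \<open>2 * N\<close> precisely because \<open>N\<close> counts the odd
numbers below \<open>t\<close>. The bound on \<open>J\<close> makes sure that no active term is cut off.
\<close>
lemma scaled_square_sum_antimono:
  fixes \<alpha> B \<mu> :: real
  assumes "0 < B" "B \<le> \<alpha>" "\<mu> \<le> (2 * real J + 1) * B" "\<mu> > 0"
  shows "(\<Sum>j<J. \<alpha> * (max 0 (\<mu> - (2 * real j + 1) * \<alpha>))\<^sup>2)
     \<le> (\<Sum>j<J. B * (max 0 (\<mu> - (2 * real j + 1) * B))\<^sup>2)"
proof (rule DERIV_nonpos_imp_nonincreasing[OF \<open>B \<le> \<alpha>\<close>])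
  fix s :: real
  assume s: "B \<le> s" "s \<le> \<alpha>"
  have s0: "s > 0" using s assms by linarith
  define P where "P j = max 0 (\<mu> - (2 * real j + 1) * s)" for j
  let ?D = "\<Sum>j<J. (P j)\<^sup>2 - 2 * s * (2 * real j + 1) * P j"
  have deriv: "((\<lambda>s. (max 0 (\<mu> - (2 * real j + 1) * s))\<^sup>2) has_real_derivative
      2 * P j * (- (2 * real j + 1))) (at s)" for j
    unfolding P_def
    by (rule DERIV_chain2[OF positive_part_square_has_derivative]) (auto intro!: derivative_eq_intros)
  have "((\<lambda>s. \<Sum>j<J. s * (max 0 (\<mu> - (2 * real j + 1) * s))\<^sup>2) has_real_derivative ?D) (at s)"
    by (rule DERIV_sum, rule DERIV_cong, rule DERIV_mult[OF DERIV_ident deriv])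
       (simp add: P_def algebra_simps)
  moreover have "?D \<le> 0"
  proof -
    (* the number of terms that are positive at s *)
    define N where "N = (LEAST n. \<mu> \<le> (2 * real n + 1) * s)"
    have J: "\<mu> \<le> (2 * real J + 1) * s"
      using assms(3) s(1) by (smt (verit) mult_left_mono of_nat_0_le_iff)
    then have N: "\<mu> \<le> (2 * real N + 1) * s" and NJ: "N \<le> J"
      unfolding N_def by (auto intro: LeastI Least_le)
    have below: "(2 * real j + 1) * s < \<mu>" if "j < N" for j
      using not_less_Least[of j "\<lambda>n. \<mu> \<le> (2 * real n + 1) * s"] that by (auto simp: N_def)
    have above: "P j = 0" if "j \<ge> N" for j
    proof -
      have "(2 * real N + 1) * s \<le> (2 * real j + 1) * s"
        using that s0 by (intro mult_right_mono) auto
      then show ?thesis using N by (simp add: P_def)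
    qed
    have "?D = (\<Sum>j<N. (P j)\<^sup>2 - 2 * s * (2 * real j + 1) * P j)"
      using NJ above by (intro sum.mono_neutral_right) auto
    also have "\<dots> = (\<Sum>j<N. s\<^sup>2 * ((\<mu> / s - (2 * real j + 1)) * (\<mu> / s - 3 * (2 * real j + 1))))"
    proof (rule sum.cong, goal_cases)
      case (2 j)
      then have "P j = \<mu> - (2 * real j + 1) * s" using below[of j] by (simp add: P_def)
      then have "\<mu> / s - (2 * real j + 1) = P j / s" "\<mu> / s - 3 * (2 * real j + 1) = P j / s - 2 * (2 * real j + 1)"
        using s0 by (simp_all add: field_simps)
      then show ?case using s0 by (simp add: field_simps power2_eq_square)
    qed simp
    also have "\<dots> = s\<^sup>2 * (real N * ((\<mu> / s - 2 * real N)\<^sup>2 - 1))"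
      by (simp only: sum_distrib_left[symmetric] sum_odd_quadratic)
    also have "\<dots> \<le> 0"
    proof (cases N)
      case (Suc n)
      have "\<mu> / s \<le> 2 * real N + 1" using N s0 by (simp add: field_simps)
      moreover have "2 * real N - 1 \<le> \<mu> / s" using below[of n] s0 Suc by (simp add: field_simps)
      ultimately have "\<bar>\<mu> / s - 2 * real N\<bar> \<le> 1" by linarith
      then have "(\<mu> / s - 2 * real N)\<^sup>2 \<le> 1" by (simp add: abs_square_le_1)
      then show ?thesis by (simp add: mult_nonneg_nonpos)
    qed simp
    finally show ?thesis .
  qed
  ultimately show "\<exists>y. ((\<lambda>s. \<Sum>j<J. s * (max 0 (\<mu> - (2 * real j + 1) * s))\<^sup>2) has_real_derivative y) (at s) \<and> y \<le> 0"
    by blast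
qed

text \<open>
By the layer cake formula this is the integral over heights \<open>t\<close> of the areas \<open>pi * (E - t)\<close> of discs.
\<close>
lemma nn_integral_truncated_paraboloid:
  fixes E :: real
  shows "(\<integral>\<^sup>+y. ennreal (E - (norm (y :: real \<times> real))\<^sup>2) \<partial>lborel) = ennreal (pi * (max 0 E)\<^sup>2 / 2)"
proof (cases "E \<ge> 0")
  case False
  then have "ennreal (E - (norm y)\<^sup>2) = 0" for y :: "real \<times> real"
    by (intro ennreal_neg) (smt (verit) zero_le_power2)
  then show ?thesis using False by simp
next
  case True
  have "(\<integral>\<^sup>+y. ennreal (E - (norm (y :: real \<times> real))\<^sup>2) \<partial>lborel)
      = (\<integral>\<^sup>+y. (\<integral>\<^sup>+t. indicator {0..E - (norm (y :: real \<times> real))\<^sup>2} t \<partial>lborel) \<partial>lborel)"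
    by (intro nn_integral_cong) (simp add: emeasure_lborel_Icc_eq ennreal_neg)
  also have "\<dots> = (\<integral>\<^sup>+t. (\<integral>\<^sup>+y. indicator {0..E - (norm (y :: real \<times> real))\<^sup>2} t \<partial>lborel) \<partial>lborel)"
  proof (rule lborel_pair.Fubini'[symmetric])
    have "(\<lambda>(y :: real \<times> real, t :: real). indicator {0..E - (norm y)\<^sup>2} t :: ennreal) =
        indicator {p. 0 \<le> snd p \<and> snd p \<le> E - (norm (fst p))\<^sup>2}"
      by (auto simp: indicator_def fun_eq_iff)
    also have "\<dots> \<in> borel_measurable (lborel \<Otimes>\<^sub>M lborel)"
      by measurable
    finally show "(\<lambda>(y :: real \<times> real, t :: real). indicator {0..E - (norm y)\<^sup>2} t :: ennreal)
        \<in> borel_measurable (lborel \<Otimes>\<^sub>M lborel)" .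
  qed
  also have "\<dots> = (\<integral>\<^sup>+t. ennreal (pi * (E - t)) * indicator {0..E} t \<partial>lborel)"
  proof (rule nn_integral_cong)
    fix t :: real
    show "(\<integral>\<^sup>+y. indicator {0..E - (norm (y :: real \<times> real))\<^sup>2} t \<partial>lborel)
        = ennreal (pi * (E - t)) * indicator {0..E} t"
    proof (cases "0 \<le> t \<and> t \<le> E")
      case True
      have "(\<integral>\<^sup>+y. indicator {0..E - (norm (y :: real \<times> real))\<^sup>2} t \<partial>lborel)
          = (\<integral>\<^sup>+y. indicator (cball 0 (sqrt (E - t))) (y :: real \<times> real) \<partial>lborel)"
      proof (rule nn_integral_cong)
        fix y :: "real \<times> real"
        have "norm y \<le> sqrt (E - t) \<longleftrightarrow> (norm y)\<^sup>2 \<le> E - t"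
          using real_sqrt_le_iff[of "(norm y)\<^sup>2" "E - t"] by simp
        then show "indicator {0..E - (norm y)\<^sup>2} t = (indicator (cball 0 (sqrt (E - t))) y :: ennreal)"
          using True by (auto simp: indicator_def)
      qed
      also have "\<dots> = ennreal (pi * (E - t))"
        using True by (simp add: emeasure_cball unit_ball_vol_2)
      finally show ?thesis using True by simp
    next
      case False
      have "indicator {0..E - (norm y)\<^sup>2} t = (0 :: ennreal)" for y :: "real \<times> real"
        using False by (auto simp: indicator_def) (smt (verit) zero_le_power2)
      then have "(\<integral>\<^sup>+y. indicator {0..E - (norm (y :: real \<times> real))\<^sup>2} t \<partial>lborel) = 0"
        by (simp only: nn_integral_const mult_zero_left)
      then show ?thesis using False by auto
    qed
  qed
  also have "\<dots> = ennreal ((- pi * (E - E)\<^sup>2 / 2) - (- pi * (E - 0)\<^sup>2 / 2))"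
    by (rule nn_integral_FTC_Icc)
       (use True in \<open>auto intro!: derivative_eq_intros mult_nonneg_nonneg simp: field_simps\<close>)
  finally show ?thesis using True by simp
qed

lemma nn_integral_plane_scale:
  fixes F :: "real \<times> real \<Rightarrow> ennreal" and a b :: real
  assumes [measurable]: "F \<in> borel_measurable borel" and ab: "a > 0" "b > 0"
  shows "(\<integral>\<^sup>+x. F x \<partial>lborel) = ennreal (a * b) * (\<integral>\<^sup>+x. F (a * fst x, b * snd x) \<partial>lborel)"
proof -
  have F: "F \<in> borel_measurable (lborel \<Otimes>\<^sub>M lborel)" by (simp add: lborel_prod)
  have F': "(\<lambda>x. F (a * fst x, b * snd x)) \<in> borel_measurable (lborel \<Otimes>\<^sub>M lborel)"
    unfolding lborel_prod
    by (rule measurable_compose[OF _ assms(1)[folded measurable_lborel1]])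
       (auto intro!: borel_measurable_continuous_onI continuous_intros)
  have "(\<integral>\<^sup>+x. F x \<partial>lborel) = (\<integral>\<^sup>+x. (\<integral>\<^sup>+y. F (x, y) \<partial>lborel) \<partial>lborel)"
    using lborel.nn_integral_fst[OF F] by (simp add: lborel_prod)
  also have "\<dots> = ennreal a * (\<integral>\<^sup>+x. (\<integral>\<^sup>+y. F (a * x, y) \<partial>lborel) \<partial>lborel)"
    using ab by (subst nn_integral_real_affine[where c = a and t = 0]) auto
  also have "\<dots> = ennreal a * (\<integral>\<^sup>+x. ennreal b * (\<integral>\<^sup>+y. F (a * x, b * y) \<partial>lborel) \<partial>lborel)"
    using ab by (subst nn_integral_real_affine[where c = b and t = 0]) auto
  also have "\<dots> = ennreal a * (ennreal b * (\<integral>\<^sup>+x. (\<integral>\<^sup>+y. F (a * x, b * y) \<partial>lborel) \<partial>lborel))"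
    by (subst nn_integral_cmult) auto
  also have "(\<integral>\<^sup>+x. (\<integral>\<^sup>+y. F (a * x, b * y) \<partial>lborel) \<partial>lborel) = (\<integral>\<^sup>+x. F (a * fst x, b * snd x) \<partial>lborel)"
    using lborel.nn_integral_fst[OF F'] by (simp add: lborel_prod)
  finally show ?thesis using ab by (simp add: ennreal_mult mult.assoc)
qed

lemma phase_space_integral:
  fixes \<omega>\<^sub>1 \<omega>\<^sub>2 \<mu> e :: real
  assumes "\<omega>\<^sub>1 > 0" "\<omega>\<^sub>2 > 0"
  shows "(\<integral>\<^sup>+x. ennreal (negative_part (e + (\<omega>\<^sub>1\<^sup>2 * (fst x)\<^sup>2 + \<omega>\<^sub>2\<^sup>2 * (snd x)\<^sup>2 - \<mu>))) \<partial>lborel)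
    = ennreal (pi * (max 0 (\<mu> - e))\<^sup>2 / (2 * \<omega>\<^sub>1 * \<omega>\<^sub>2))"
proof -
  let ?F = "\<lambda>y :: real \<times> real. ennreal ((\<mu> - e) - (norm y)\<^sup>2)"
  have "(\<integral>\<^sup>+x. ennreal (negative_part (e + (\<omega>\<^sub>1\<^sup>2 * (fst x)\<^sup>2 + \<omega>\<^sub>2\<^sup>2 * (snd x)\<^sup>2 - \<mu>))) \<partial>lborel)
     = (\<integral>\<^sup>+x. ?F (\<omega>\<^sub>1 * fst x, \<omega>\<^sub>2 * snd x) \<partial>lborel)"
    by (intro nn_integral_cong)
       (simp add: negative_part_def norm_Pair real_sqrt_pow2 power_mult_distrib max_def ennreal_neg algebra_simps)
  also have "\<dots> = ennreal (1 / (\<omega>\<^sub>1 * \<omega>\<^sub>2)) * (ennreal (\<omega>\<^sub>1 * \<omega>\<^sub>2) * (\<integral>\<^sup>+x. ?F (\<omega>\<^sub>1 * fst x, \<omega>\<^sub>2 * snd x) \<partial>lborel))"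
    using assms by (simp add: mult.assoc[symmetric] ennreal_mult'[symmetric] flip: ennreal_mult)
  also have "\<dots> = ennreal (1 / (\<omega>\<^sub>1 * \<omega>\<^sub>2)) * (\<integral>\<^sup>+x. ?F x \<partial>lborel)"
    using assms by (subst nn_integral_plane_scale[of ?F \<omega>\<^sub>1 \<omega>\<^sub>2]) auto
  also have "\<dots> = ennreal (pi * (max 0 (\<mu> - e))\<^sup>2 / (2 * \<omega>\<^sub>1 * \<omega>\<^sub>2))"
    unfolding nn_integral_truncated_paraboloid
    using assms by (subst ennreal_mult[symmetric]) (auto simp: field_simps)
  finally show ?thesis .
qed

lemma oscillator_sum_le:
  fixes \<alpha> \<beta> B \<omega>\<^sub>1 \<omega>\<^sub>2 \<mu> :: real
  assumes pos: "0 < B" "0 < \<beta>" "\<mu> > 0" "\<omega>\<^sub>1 > 0" "\<omega>\<^sub>2 > 0" and \<alpha>: "B \<le> \<alpha>" and prod: "\<alpha> * \<beta> = \<omega>\<^sub>1 * \<omega>\<^sub>2"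
    and J: "\<mu> \<le> (2 * real J + 1) * B"
  shows "ennreal (\<Sum>j<J. \<Sum>k<K. max 0 (\<mu> - (2 * real j + 1) * \<alpha> - (2 * real k + 1) * \<beta>))
    \<le> ennreal (B / (2 * pi)) *
      (\<Sum>m. \<integral>\<^sup>+x. ennreal (negative_part ((2 * real m + 1) * B +
          (\<omega>\<^sub>1\<^sup>2 * (fst x)\<^sup>2 + \<omega>\<^sub>2\<^sup>2 * (snd x)\<^sup>2 - \<mu>))) \<partial>lborel)"
proof -
  have \<alpha>0: "\<alpha> > 0" using \<alpha> pos by linarith
  have "(\<Sum>j<J. \<Sum>k<K. max 0 (\<mu> - (2 * real j + 1) * \<alpha> - (2 * real k + 1) * \<beta>))
     \<le> (\<Sum>j<J. (max 0 (\<mu> - (2 * real j + 1) * \<alpha>))\<^sup>2 / (4 * \<beta>))"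
    by (intro sum_mono midpoint_sum_le pos)
  also have "\<dots> = (\<Sum>j<J. \<alpha> * (max 0 (\<mu> - (2 * real j + 1) * \<alpha>))\<^sup>2) / (4 * \<omega>\<^sub>1 * \<omega>\<^sub>2)"
  proof -
    have "y / (4 * \<beta>) = \<alpha> * y / (4 * \<omega>\<^sub>1 * \<omega>\<^sub>2)" for y
      using prod pos \<alpha>0 by (simp add: field_simps)
    then show ?thesis by (simp add: sum_divide_distrib)
  qed
  also have "\<dots> \<le> (\<Sum>j<J. B * (max 0 (\<mu> - (2 * real j + 1) * B))\<^sup>2) / (4 * \<omega>\<^sub>1 * \<omega>\<^sub>2)"
    using scaled_square_sum_antimono[OF pos(1) \<alpha> J pos(3)] pos by (intro divide_right_mono) auto
  also have "\<dots> = B / (2 * pi) * (\<Sum>j<J. pi * (max 0 (\<mu> - (2 * real j + 1) * B))\<^sup>2 / (2 * \<omega>\<^sub>1 * \<omega>\<^sub>2))"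
    by (simp add: sum_distrib_left sum_divide_distrib field_simps)
  finally have "ennreal (\<Sum>j<J. \<Sum>k<K. max 0 (\<mu> - (2 * real j + 1) * \<alpha> - (2 * real k + 1) * \<beta>))
     \<le> ennreal (B / (2 * pi) * (\<Sum>j<J. pi * (max 0 (\<mu> - (2 * real j + 1) * B))\<^sup>2 / (2 * \<omega>\<^sub>1 * \<omega>\<^sub>2)))"
    by (rule ennreal_leI)
  also have "\<dots> = ennreal (B / (2 * pi)) *
      (\<Sum>j<J. ennreal (pi * (max 0 (\<mu> - (2 * real j + 1) * B))\<^sup>2 / (2 * \<omega>\<^sub>1 * \<omega>\<^sub>2)))"
    using pos by (subst ennreal_mult) (auto intro!: sum_nonneg simp: sum_ennreal)
  also have "\<dots> \<le> ennreal (B / (2 * pi)) *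
      (\<Sum>m. ennreal (pi * (max 0 (\<mu> - (2 * real m + 1) * B))\<^sup>2 / (2 * \<omega>\<^sub>1 * \<omega>\<^sub>2)))"
    by (intro mult_left_mono sum_le_suminf) auto
  finally show ?thesis using pos by (simp add: phase_space_integral)
qed

section \<open>Functions determined by their moments\<close>

lemma norm_exp_partial_sum_le:
  fixes z :: complex
  shows "norm (\<Sum>k<N. z ^ k / fact k) \<le> exp (norm z)"
proof -
  have "norm (\<Sum>k<N. z ^ k / fact k) \<le> (\<Sum>k<N. norm z ^ k / fact k)"
    by (rule order_trans[OF norm_sum]) (simp add: norm_divide norm_power)
  also have "\<dots> \<le> (\<Sum>k. norm z ^ k / fact k)"
    using summable_exp_generic[of "norm z"] by (intro sum_le_suminf) (auto simp: field_simps scaleR_conv_of_real)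
  also have "\<dots> = exp (norm z)"
    by (simp add: exp_def field_simps)
  finally show ?thesis .
qed

lemma power_le_exp_mult:
  fixes x :: real
  shows "\<bar>x\<bar> ^ n \<le> exp (real n * \<bar>x\<bar>)"
proof -
  have "\<bar>x\<bar> \<le> exp \<bar>x\<bar>" using exp_ge_add_one_self[of "\<bar>x\<bar>"] by linarith
  then have "\<bar>x\<bar> ^ n \<le> exp \<bar>x\<bar> ^ n" by (intro power_mono) auto
  then show ?thesis by (simp add: exp_of_nat_mult)
qed

text \<open>
Exponential integrability of every order dominates the partial sums of the exponential series, so
the Fourier transform may be expanded term by term at every point and no analytic continuation is
involved.
\<close>
lemma fourier_transform_eq_0_if_moments_eq_0:
  fixes w :: "real \<Rightarrow> real"
  assumes [measurable]: "w \<in> borel_measurable borel"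
    and int: "\<And>c::nat. integrable lborel (\<lambda>x. exp (real c * \<bar>x\<bar>) * w x)"
    and mom: "\<And>n. (\<integral>x. x ^ n * w x \<partial>lborel) = 0"
  shows "(\<integral>x. complex_of_real (w x) * iexp (t * x) \<partial>lborel) = 0"
proof -
  obtain c :: nat where c: "\<bar>t\<bar> \<le> real c" using real_arch_simple by blast
  have intp: "integrable lborel (\<lambda>x. x ^ n * w x)" for n
    by (rule Bochner_Integration.integrable_bound[OF int[of n]])
       (auto simp: abs_mult power_abs power_le_exp_mult intro!: mult_right_mono)
  let ?S = "\<lambda>N x. \<Sum>k<N. (\<i> * t) ^ k / fact k * complex_of_real (x ^ k * w x)"
  have S: "?S N x = complex_of_real (w x) * (\<Sum>k<N. (\<i> * (t * x)) ^ k / fact k)" for N x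
    by (simp add: sum_distrib_left power_mult_distrib field_simps)
  have "(\<lambda>N. \<integral>x. ?S N x \<partial>lborel) \<longlonglongrightarrow> (\<integral>x. complex_of_real (w x) * iexp (t * x) \<partial>lborel)"
  proof (rule integral_dominated_convergence)
    show "integrable lborel (\<lambda>x. \<bar>exp (real c * \<bar>x\<bar>) * w x\<bar>)"
      using int[of c] by (rule integrable_abs)
    show "AE x in lborel. (\<lambda>N. ?S N x) \<longlonglongrightarrow> complex_of_real (w x) * iexp (t * x)"
    proof (rule AE_I2)
      fix x :: real
      have "(\<lambda>k. (\<i> * (t * x)) ^ k / fact k) sums iexp (t * x)"
        using exp_converges[of "\<i> * (t * x)"] by (simp add: scaleR_conv_of_real field_simps)
      then show "(\<lambda>N. ?S N x) \<longlonglongrightarrow> complex_of_real (w x) * iexp (t * x)"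
        unfolding S sums_def by (intro tendsto_intros)
    qed
    show "AE x in lborel. norm (?S N x) \<le> \<bar>exp (real c * \<bar>x\<bar>) * w x\<bar>" for N
    proof (rule AE_I2)
      fix x :: real
      have "norm (?S N x) \<le> \<bar>w x\<bar> * exp (norm (\<i> * (t * x)))"
        unfolding S
        by (subst norm_mult, subst norm_of_real, rule mult_left_mono[OF norm_exp_partial_sum_le]) simp
      also have "\<dots> \<le> \<bar>w x\<bar> * exp (real c * \<bar>x\<bar>)"
        using c by (intro mult_left_mono) (auto simp: norm_mult abs_mult intro!: mult_right_mono)
      finally show "norm (?S N x) \<le> \<bar>exp (real c * \<bar>x\<bar>) * w x\<bar>"
        by (simp add: abs_mult mult.commute)
    qed
  qed auto
  moreover have "(\<integral>x. ?S N x \<partial>lborel) = 0" for N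
  proof -
    have ic: "integrable lborel (\<lambda>x. (\<i> * t) ^ k / fact k * complex_of_real (x ^ k * w x))" for k
      using intp by (intro integrable_mult_right integrable_of_real)
    have "(\<integral>x. ?S N x \<partial>lborel) = (\<Sum>k<N. (\<i> * t) ^ k / fact k * complex_of_real (\<integral>x. x ^ k * w x \<partial>lborel))"
      using ic by (subst Bochner_Integration.integral_sum) (simp_all only: integral_mult_right_zero integral_complex_of_real)
    then show ?thesis by (simp add: mom)
  qed
  ultimately show ?thesis by (simp add: LIMSEQ_const_iff)
qed

text \<open>
The positive and the negative part of \<open>w\<close> have the same mass and the same Fourier transform; after
normalisation they are densities of probability measures with equal characteristic functions, and
Levy's uniqueness theorem applies.
\<close>
lemma AE_eq_0_if_moments_eq_0_real:
  fixes w :: "real \<Rightarrow> real"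
  assumes meas[measurable]: "w \<in> borel_measurable borel"
    and int: "\<And>c::nat. integrable lborel (\<lambda>x. exp (real c * \<bar>x\<bar>) * w x)"
    and mom: "\<And>n. (\<integral>x. x ^ n * w x \<partial>lborel) = 0"
  shows "AE x in lborel. w x = 0"
proof -
  have intw: "integrable lborel w" using int[of 0] by simp
  define wp where "wp = (\<lambda>x. max 0 (w x))"
  define wm where "wm = (\<lambda>x. max 0 (- w x))"
  have [measurable]: "wp \<in> borel_measurable borel" "wm \<in> borel_measurable borel"
    by (auto simp: wp_def wm_def)
  have nonneg: "wp x \<ge> 0" "wm x \<ge> 0" for x by (auto simp: wp_def wm_def)
  have w: "w x = wp x - wm x" for x by (auto simp: wp_def wm_def)
  have ip: "integrable lborel wp" and im: "integrable lborel wm"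
    using intw by (auto simp: wp_def wm_def)
  define C where "C = (\<integral>x. wp x \<partial>lborel)"
  have Cm: "(\<integral>x. wm x \<partial>lborel) = C"
    using mom[of 0] ip im by (simp add: w C_def)
  have "C \<ge> 0" unfolding C_def using nonneg by simp
  show ?thesis
  proof (cases "C = 0")
    case True
    then have "AE x in lborel. wp x = 0" "AE x in lborel. wm x = 0"
      using Cm C_def integral_nonneg_eq_0_iff_AE[OF ip] integral_nonneg_eq_0_iff_AE[OF im] nonneg by auto
    then show ?thesis by eventually_elim (simp add: w)
  next
    case False
    with \<open>C \<ge> 0\<close> have C: "C > 0" by simp
    let ?M = "\<lambda>v. density lborel (\<lambda>x. ennreal (v x / C))"
    have distr: "real_distribution (?M v)"
      if [measurable]: "v \<in> borel_measurable borel" and v: "integrable lborel v" "\<And>x. v x \<ge> 0"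
        "(\<integral>x. v x \<partial>lborel) = C" for v
    proof -
      have "(\<integral>\<^sup>+x. ennreal (v x / C) \<partial>lborel) = ennreal (\<integral>x. v x / C \<partial>lborel)"
        using v C by (intro nn_integral_eq_integral) auto
      then have "prob_space (?M v)"
        using v C by (intro prob_spaceI) (simp add: emeasure_density)
      then show ?thesis
        by (simp add: real_distribution_def real_distribution_axioms_def)
    qed
    have ch: "char (?M v) t = (\<integral>x. complex_of_real (v x / C) * iexp (t * x) \<partial>lborel)"
      if [measurable]: "v \<in> borel_measurable borel" and v: "\<And>x. v x \<ge> 0" for v t
      unfolding char_def using v C by (subst integral_density) (auto simp: scaleR_conv_of_real)
    have icx: "integrable lborel (\<lambda>x. complex_of_real (v x / C) * iexp (t * x))"
      if [measurable]: "v \<in> borel_measurable borel" and v: "integrable lborel v" for v t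
    proof (rule Bochner_Integration.integrable_bound)
      show "integrable lborel (\<lambda>x. v x / C)" using v by simp
    qed (auto simp: norm_mult norm_divide simp flip: of_real_mult)
    have "char (?M wp) t = char (?M wm) t" for t
    proof -
      have "char (?M wp) t - char (?M wm) t =
        (\<integral>x. complex_of_real (wp x / C) * iexp (t * x) - complex_of_real (wm x / C) * iexp (t * x) \<partial>lborel)"
        using nonneg ip im icx by (simp add: ch Bochner_Integration.integral_diff)
      also have "\<dots> = (\<integral>x. complex_of_real (w x) * iexp (t * x) / C \<partial>lborel)"
        by (intro Bochner_Integration.integral_cong) (auto simp: w left_diff_distrib diff_divide_distrib)
      also have "\<dots> = 0"
        using fourier_transform_eq_0_if_moments_eq_0[OF meas int mom] by simp
      finally show ?thesis by simp
    qed
    then have "?M wp = ?M wm"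
      using nonneg ip im Cm C_def by (intro Levy_uniqueness distr) auto
    then have "AE x in lborel. ennreal (wp x / C) = ennreal (wm x / C)"
      by (intro sigma_finite_measure.density_unique[OF lborel.sigma_finite_measure_axioms]) auto
    then show ?thesis
    proof eventually_elim
      case (elim x)
      then show ?case using C nonneg[of x] by (simp add: w)
    qed
  qed
qed

text \<open>
The one-dimensional result is used twice: first for the partial moments \<open>h n\<close> in the second
variable, as functions of the first one, and then for almost every section of \<open>W\<close>. Since there are
only countably many \<open>n\<close>, the exceptional null sets can be united.
\<close>
lemma AE_eq_0_if_moments_eq_0_plane_real:
  fixes W :: "real \<times> real \<Rightarrow> real"
  assumes meas[measurable]: "W \<in> borel_measurable borel"
    and int: "\<And>c::nat. integrable lborel (\<lambda>x. exp (real c * (\<bar>fst x\<bar> + \<bar>snd x\<bar>)) * W x)"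
    and mom: "\<And>m n. (\<integral>x. fst x ^ m * snd x ^ n * W x \<partial>lborel) = 0"
  shows "AE x in lborel. W x = 0"
proof -
  have [measurable]: "W \<in> borel_measurable (lborel \<Otimes>\<^sub>M lborel)"
    using meas by (simp add: lborel_prod)
  have int_prod: "integrable (lborel \<Otimes>\<^sub>M lborel) (\<lambda>x. (exp (real c * \<bar>fst x\<bar>) * fst x ^ m * snd x ^ n) * W x)" for c m n
  proof (rule Bochner_Integration.integrable_bound)
    show "integrable (lborel \<Otimes>\<^sub>M lborel) (\<lambda>x. exp (real (c + m + n) * (\<bar>fst x\<bar> + \<bar>snd x\<bar>)) * W x)"
      using int[of "c + m + n"] by (simp add: lborel_prod)
    show "AE x in lborel \<Otimes>\<^sub>M lborel. norm (exp (real c * \<bar>fst x\<bar>) * fst x ^ m * snd x ^ n * W x)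
        \<le> norm (exp (real (c + m + n) * (\<bar>fst x\<bar> + \<bar>snd x\<bar>)) * W x)"
    proof (rule AE_I2)
      fix x :: "real \<times> real"
      have "exp (real c * \<bar>fst x\<bar>) * \<bar>fst x\<bar> ^ m * \<bar>snd x\<bar> ^ n
          \<le> exp (real c * \<bar>fst x\<bar>) * exp (real m * \<bar>fst x\<bar>) * exp (real n * \<bar>snd x\<bar>)"
        by (intro mult_mono power_le_exp_mult) auto
      also have "\<dots> \<le> exp (real (c + m + n) * (\<bar>fst x\<bar> + \<bar>snd x\<bar>))"
        by (simp add: exp_add[symmetric] algebra_simps)
      finally show "norm (exp (real c * \<bar>fst x\<bar>) * fst x ^ m * snd x ^ n * W x)
        \<le> norm (exp (real (c + m + n) * (\<bar>fst x\<bar> + \<bar>snd x\<bar>)) * W x)"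
        by (auto simp: abs_mult power_abs intro!: mult_right_mono)
    qed
  qed measurable
  define h where "h n x = (\<integral>y. y ^ n * W (x, y) \<partial>lborel)" for n x
  have [measurable]: "h n \<in> borel_measurable borel" for n
    unfolding h_def by measurable
  have "AE x in lborel. h n x = 0" for n
  proof (rule AE_eq_0_if_moments_eq_0_real)
    have pull: "(\<integral>y. exp (real c * \<bar>x\<bar>) * x ^ m * y ^ n * W (x, y) \<partial>lborel) = exp (real c * \<bar>x\<bar>) * x ^ m * h n x" for c m x
      unfolding h_def mult.assoc by simp
    show "integrable lborel (\<lambda>x. exp (real c * \<bar>x\<bar>) * h n x)" for c :: nat
      using lborel_pair.integrable_fst'[OF int_prod[of c 0 n]] pull[of c _ 0] by simp
    show "(\<integral>x. x ^ m * h n x \<partial>lborel) = 0" for m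
      using lborel_pair.integral_fst'[OF int_prod[of 0 m n]] pull[of 0 _ m] mom[of m n]
      by (simp add: lborel_prod)
  qed simp
  then have h0: "AE x in lborel. \<forall>n. h n x = 0" by (simp add: AE_all_countable)
  have "AE x in lborel. integrable lborel (\<lambda>y. exp (real c * \<bar>y\<bar>) * W (x, y))" for c :: nat
  proof -
    have "integrable (lborel \<Otimes>\<^sub>M lborel) (\<lambda>x. exp (real c * \<bar>snd x\<bar>) * W x)"
    proof (rule Bochner_Integration.integrable_bound)
      show "integrable (lborel \<Otimes>\<^sub>M lborel) (\<lambda>x. exp (real c * (\<bar>fst x\<bar> + \<bar>snd x\<bar>)) * W x)"
        using int[of c] by (simp add: lborel_prod)
    qed (auto intro!: AE_I2 mult_right_mono mult_left_mono simp: abs_mult)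
    from lborel_pair.AE_integrable_fst'[OF this] show ?thesis by simp
  qed
  then have "AE x in lborel. \<forall>c::nat. integrable lborel (\<lambda>y. exp (real c * \<bar>y\<bar>) * W (x, y))"
    by (simp add: AE_all_countable)
  with h0 have "AE x in lborel. AE y in lborel. W (x, y) = 0"
  proof eventually_elim
    case (elim x)
    show ?case
      by (rule AE_eq_0_if_moments_eq_0_real) (use elim in \<open>auto simp: h_def\<close>)
  qed
  moreover have "{x \<in> space (lborel \<Otimes>\<^sub>M lborel). W x = 0} \<in> sets (lborel \<Otimes>\<^sub>M lborel)"
    by measurable
  ultimately have "AE x in lborel \<Otimes>\<^sub>M lborel. W x = 0"
    by (intro lborel_pair.AE_pair_measure)
  then show ?thesis unfolding lborel_prod .
qed

lemma AE_eq_0_if_moments_eq_0_plane: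
  fixes W :: "real \<times> real \<Rightarrow> complex"
  assumes meas[measurable]: "W \<in> borel_measurable borel"
    and int: "\<And>c::nat. integrable lborel (\<lambda>x. complex_of_real (exp (real c * (\<bar>fst x\<bar> + \<bar>snd x\<bar>))) * W x)"
    and mom: "\<And>m n. (\<integral>x. complex_of_real (fst x ^ m * snd x ^ n) * W x \<partial>lborel) = 0"
  shows "AE x in lborel. W x = 0"
proof -
  have intp: "integrable lborel (\<lambda>x. complex_of_real (fst x ^ m * snd x ^ n) * W x)" for m n
  proof (rule Bochner_Integration.integrable_bound[OF int[of "m + n"]])
    show "AE x in lborel. norm (complex_of_real (fst x ^ m * snd x ^ n) * W x) \<le> norm (complex_of_real (exp (real (m + n) * (\<bar>fst x\<bar> + \<bar>snd x\<bar>))) * W x)"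
    proof (rule AE_I2)
      fix x :: "real \<times> real"
      have "\<bar>fst x\<bar> ^ m * \<bar>snd x\<bar> ^ n \<le> exp (real m * \<bar>fst x\<bar>) * exp (real n * \<bar>snd x\<bar>)"
        by (intro mult_mono power_le_exp_mult) auto
      also have "\<dots> \<le> exp (real (m + n) * (\<bar>fst x\<bar> + \<bar>snd x\<bar>))"
        by (simp add: exp_add[symmetric] algebra_simps)
      finally show "norm (complex_of_real (fst x ^ m * snd x ^ n) * W x) \<le> norm (complex_of_real (exp (real (m + n) * (\<bar>fst x\<bar> + \<bar>snd x\<bar>))) * W x)"
        by (auto simp: norm_mult norm_power abs_mult power_abs intro!: mult_right_mono)
    qed
  qed (intro borel_measurable_times, auto intro!: borel_measurable_continuous_onI continuous_intros simp: meas)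
  have "AE x in lborel. Re (W x) = 0"
  proof (rule AE_eq_0_if_moments_eq_0_plane_real)
    show "integrable lborel (\<lambda>x. exp (real c * (\<bar>fst x\<bar> + \<bar>snd x\<bar>)) * Re (W x))" for c
      using integrable_Re[OF int[of c]] by simp
    show "(\<integral>x. fst x ^ m * snd x ^ n * Re (W x) \<partial>lborel) = 0" for m n
      using integral_Re[OF intp[of m n]] mom[of m n] by simp
  qed simp
  moreover have "AE x in lborel. Im (W x) = 0"
  proof (rule AE_eq_0_if_moments_eq_0_plane_real)
    show "integrable lborel (\<lambda>x. exp (real c * (\<bar>fst x\<bar> + \<bar>snd x\<bar>)) * Im (W x))" for c
      using integrable_Im[OF int[of c]] by simp
    show "(\<integral>x. fst x ^ m * snd x ^ n * Im (W x) \<partial>lborel) = 0" for m n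
      using integral_Im[OF intp[of m n]] mom[of m n] by simp
  qed simp
  ultimately show ?thesis by eventually_elim (simp add: complex_eq_iff)
qed

section \<open>Underdetermined linear systems\<close>

lemma homogeneous_system_nontrivial_solution:
  fixes A :: "'a \<Rightarrow> 'b \<Rightarrow> complex"
  assumes "finite I" "finite J" "card I < card J"
  shows "\<exists>c. (\<exists>i\<in>J. c i \<noteq> 0) \<and> (\<forall>e\<in>I. (\<Sum>i\<in>J. c i * A e i) = 0)"
  using assms
proof (induction I arbitrary: J A rule: finite_induct)
  case empty
  then obtain i where "i \<in> J" by fastforce
  then show ?case by (intro exI[of _ "\<lambda>_. 1"]) auto
next
  case (insert e I)
  show ?case
  proof (cases "\<forall>i\<in>J. A e i = 0")
    case True
    obtain c where "\<exists>i\<in>J. c i \<noteq> 0" "\<forall>e\<in>I. (\<Sum>i\<in>J. c i * A e i) = 0"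
      using insert.IH[of J A] insert.prems insert.hyps by (metis Suc_lessD card_insert_disjoint)
    then show ?thesis using True by (intro exI[of _ c]) auto
  next
    case False
    then obtain i0 where i0: "i0 \<in> J" "A e i0 \<noteq> 0" by blast
    define J' where "J' = J - {i0}"
    have J: "J = insert i0 J'" "i0 \<notin> J'" "finite J'" using i0 insert by (auto simp: J'_def)
    (* Gaussian elimination of the unknown i0 by means of the equation e *)
    obtain c where c: "\<exists>i\<in>J'. c i \<noteq> 0"
      "\<And>f. f \<in> I \<Longrightarrow> (\<Sum>i\<in>J'. c i * (A f i - A f i0 * A e i / A e i0)) = 0"
    proof -
      have "card I < card J'" using insert.prems insert.hyps i0 by (simp add: J'_def)
      then show ?thesis
        using that insert.IH[OF \<open>finite J'\<close>, of "\<lambda>f i. A f i - A f i0 * A e i / A e i0"] by blast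
    qed
    define s where "s = (\<Sum>i\<in>J'. c i * A e i)"
    define d where "d = c(i0 := - s / A e i0)"
    have sum_d: "(\<Sum>i\<in>J. d i * A f i) = - s / A e i0 * A f i0 + (\<Sum>i\<in>J'. c i * A f i)" for f
      using J by (auto simp: d_def intro!: sum.cong)
    have "(\<Sum>i\<in>J. d i * A f i) = 0" if "f \<in> I" for f
    proof -
      have "0 = (\<Sum>i\<in>J'. c i * A f i) - A f i0 / A e i0 * s"
        using c(2)[OF that] unfolding s_def sum_distrib_left sum_subtractf[symmetric]
        by (simp add: algebra_simps)
      then show ?thesis unfolding sum_d by simp
    qed
    moreover have "(\<Sum>i\<in>J. d i * A e i) = 0"
      unfolding sum_d using i0 by (simp add: s_def)
    moreover have "\<exists>i\<in>J. d i \<noteq> 0"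
      using c(1) J by (auto simp: d_def)
    ultimately show ?thesis by (intro exI[of _ d]) auto
  qed
qed

section \<open>A class of smooth functions closed under differentiation\<close>

text \<open>
The functions \<open>y^(-m) * exp (-1 / y)\<close> on the positive half-line. Their span is closed under
differentiation, and \<open>flat 0\<close> is the standard smooth function that vanishes on the negative half-line.
\<close>
definition flat :: "nat \<Rightarrow> real \<Rightarrow> real" where
  "flat m y = (if y > 0 then exp (- (1 / y)) / y ^ m else 0)"

lemma flat_nonneg: "0 \<le> flat m y"
  by (simp add: flat_def)

lemma flat_0_le_1: "flat 0 y \<le> 1"
  by (simp add: flat_def)

lemma flat_2_le_2: "flat 2 y \<le> 2"
proof (cases "y > 0")
  case True
  let ?t = "1 / y"
  have "?t\<^sup>2 \<le> 2 * exp ?t"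
  proof -
    have "?t > 0" using True by simp
    then show ?thesis using exp_lower_Taylor_quadratic[of ?t] by linarith
  qed
  then have "?t\<^sup>2 * exp (- ?t) \<le> (2 * exp ?t) * exp (- ?t)"
    by (intro mult_right_mono) auto
  also have "\<dots> = 2" by (simp add: exp_minus)
  finally show ?thesis using True by (simp add: flat_def power_one_over)
qed (simp add: flat_def)

lemma tendsto_flat_0: "(flat m \<longlongrightarrow> 0) (at 0)"
proof (rule filterlim_split_at)
  show "(flat m \<longlongrightarrow> 0) (at_left 0)"
    by (rule Lim_transform_eventually[OF tendsto_const])
       (auto simp: flat_def eventually_at_filter)
  have "((\<lambda>t. flat m (inverse t)) \<longlongrightarrow> 0) at_top"
  proof (rule Lim_transform_eventually[OF tendsto_power_div_exp_0[of m]])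
    show "\<forall>\<^sub>F t in at_top. t ^ m / exp t = flat m (inverse t)"
      using eventually_gt_at_top[of 0]
      by eventually_elim (simp add: flat_def exp_minus field_simps power_inverse)
  qed
  then show "(flat m \<longlongrightarrow> 0) (at_right 0)"
    by (simp add: filterlim_at_right_to_top)
qed

lemma flat_has_derivative:
  "(flat m has_real_derivative flat (m + 2) y - real m * flat (m + 1) y) (at y)"
proof -
  consider "y > 0" | "y < 0" | "y = 0" by linarith
  then show ?thesis
  proof cases
    case 1
    have "((\<lambda>y. exp (- (1 / y)) / y ^ m) has_real_derivative flat (m + 2) y - real m * flat (m + 1) y) (at y)"
    proof (rule DERIV_cong)
      have "((\<lambda>y. exp (- (1 / y))) has_real_derivative exp (- (1 / y)) / y\<^sup>2) (at y)"
        using 1 by (auto intro!: derivative_eq_intros simp: power2_eq_square divide_inverse)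
      from DERIV_divide[OF this DERIV_pow] 1
      show "((\<lambda>y. exp (- (1 / y)) / y ^ m) has_real_derivative
          (exp (- (1 / y)) / y\<^sup>2 * y ^ m - exp (- (1 / y)) * (real m * y ^ (m - Suc 0))) / (y ^ m * y ^ m)) (at y)"
        by simp
      show "(exp (- (1 / y)) / y\<^sup>2 * y ^ m - exp (- (1 / y)) * (real m * y ^ (m - Suc 0))) / (y ^ m * y ^ m)
          = flat (m + 2) y - real m * flat (m + 1) y"
        using 1 by (cases m) (simp_all add: flat_def field_simps power2_eq_square)
    qed
    then show ?thesis
      by (rule has_field_derivative_transform_within_open[of _ _ _ "{0<..}"]) (use 1 in \<open>auto simp: flat_def\<close>)
  next
    case 2
    have "((\<lambda>y. 0) has_real_derivative flat (m + 2) y - real m * flat (m + 1) y) (at y)"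
      using 2 by (simp add: flat_def)
    then show ?thesis
      by (rule has_field_derivative_transform_within_open[of _ _ _ "{..<0}"]) (use 2 in \<open>auto simp: flat_def\<close>)
  next
    case 3
    have "(\<lambda>h. flat m h / h) = flat (Suc m)"
      by (auto simp: flat_def fun_eq_iff)
    then show ?thesis using 3 tendsto_flat_0[of "Suc m"] by (simp add: DERIV_def flat_def)
  qed
qed

lemma tendsto_flat_at_top: "(flat m \<longlongrightarrow> (if m = 0 then 1 else 0)) at_top"
proof -
  have inv: "((\<lambda>y::real. 1 / y) \<longlongrightarrow> 0) at_top"
    by (simp add: tendsto_inverse_0_at_top[OF filterlim_ident] inverse_eq_divide[symmetric])
  have "((\<lambda>y::real. exp (- (1 / y)) * (1 / y) ^ m) \<longlongrightarrow> exp (- 0) * 0 ^ m) at_top"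
    by (intro tendsto_intros inv)
  moreover have "\<forall>\<^sub>F y in at_top. exp (- (1 / y)) * (1 / y) ^ m = flat m y"
    using eventually_gt_at_top[of 0] by eventually_elim (simp add: flat_def power_one_over field_simps)
  ultimately have "(flat m \<longlongrightarrow> exp (- 0) * 0 ^ m) at_top"
    by (rule Lim_transform_eventually)
  then show ?thesis by (simp add: power_0_left split: if_splits)
qed

text \<open>
Formal expressions for smooth functions on the plane; \<open>Flat m p q r\<close> stands for \<open>flat m\<close> applied to
the affine function \<open>p * x1 + q * x2 + r\<close>. Differentiation is a syntactic operation on them, so that
mixed derivatives of all orders are available at once and their symmetry is an induction over the
syntax.
\<close>
datatype expr = Const complex | X1 | X2 | Add expr expr | Mul expr expr | Exp expr
  | Flat nat real real real

primrec eval :: "expr \<Rightarrow> plane \<Rightarrow> complex" where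
  "eval (Const c) x = c"
| "eval X1 x = of_real (fst x)"
| "eval X2 x = of_real (snd x)"
| "eval (Add e f) x = eval e x + eval f x"
| "eval (Mul e f) x = eval e x * eval f x"
| "eval (Exp e) x = exp (eval e x)"
| "eval (Flat m p q r) x = of_real (flat m (p * fst x + q * snd x + r))"

text \<open>
The direction \<open>d\<close> is an argument in which the derivative is linear, so that \<open>\<lambda>d. eval (D d e) x\<close> is the
total derivative of \<open>eval e\<close> at \<open>x\<close>.
\<close>
primrec D :: "plane \<Rightarrow> expr \<Rightarrow> expr" where
  "D d (Const c) = Const 0"
| "D d X1 = Const (of_real (fst d))"
| "D d X2 = Const (of_real (snd d))"
| "D d (Add e f) = Add (D d e) (D d f)"
| "D d (Mul e f) = Add (Mul (D d e) f) (Mul e (D d f))"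
| "D d (Exp e) = Mul (D d e) (Exp e)"
| "D d (Flat m p q r) = Mul (Const (of_real (p * fst d + q * snd d)))
     (Add (Flat (m + 2) p q r) (Mul (Const (- of_nat m)) (Flat (m + 1) p q r)))"

primrec conj_expr :: "expr \<Rightarrow> expr" where
  "conj_expr (Const c) = Const (cnj c)"
| "conj_expr X1 = X1"
| "conj_expr X2 = X2"
| "conj_expr (Add e f) = Add (conj_expr e) (conj_expr f)"
| "conj_expr (Mul e f) = Mul (conj_expr e) (conj_expr f)"
| "conj_expr (Exp e) = Exp (conj_expr e)"
| "conj_expr (Flat m p q r) = Flat m p q r"

lemma eval_conj_expr: "eval (conj_expr e) x = cnj (eval e x)"
  by (induction e) (auto simp: exp_cnj)

lemma D_conj_expr: "D d (conj_expr e) = conj_expr (D d e)"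
  by (induction e) auto

lemma eval_has_derivative: "(eval e has_derivative (\<lambda>h. eval (D h e) x)) (at x)"
proof (induction e)
  case (Flat m p q r)
  have "((\<lambda>x. p * fst x + q * snd x + r) has_derivative (\<lambda>h. p * fst h + q * snd h)) (at x)"
    by (auto intro!: derivative_eq_intros)
  from has_derivative_compose[OF this, OF flat_has_derivative[of m, THEN has_field_derivative_imp_has_derivative]]
  have "((\<lambda>x. complex_of_real (flat m (p * fst x + q * snd x + r))) has_derivative
     (\<lambda>h. complex_of_real ((flat (m + 2) (p * fst x + q * snd x + r) - real m * flat (m + 1) (p * fst x + q * snd x + r)) * (p * fst h + q * snd h)))) (at x)"
    by (rule has_derivative_of_real)
  then show ?case by (simp add: algebra_simps eval.simps(7)[abs_def])
next
  case (Exp e)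
  have "((\<lambda>x. exp (eval e x)) has_derivative (\<lambda>h. exp (eval e x) * eval (D h e) x)) (at x)"
    by (rule has_derivative_compose[OF Exp]) (use DERIV_exp in \<open>auto simp: has_field_derivative_def\<close>)
  then show ?case by (simp add: mult.commute eval.simps(6)[abs_def])
next
  case (Mul e f)
  then show ?case
    by (auto intro!: derivative_eq_intros simp: eval.simps(5)[abs_def])
next
  case (Add e f)
  then show ?case
    by (auto intro!: derivative_eq_intros simp: eval.simps(4)[abs_def])
qed (auto intro!: derivative_eq_intros simp: eval.simps(1-3)[abs_def])

lemma eval_D_split: "eval (D h e) x = of_real (fst h) * eval (D (1, 0) e) x + of_real (snd h) * eval (D (0, 1) e) x"
  by (induction e) (auto simp: algebra_simps)

lemma eval_D_commute: "eval (D d (D d' e)) x = eval (D d' (D d e)) x"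
  by (induction e) (auto simp: algebra_simps)

lemma eval_D_cong:
  assumes "\<And>x. eval e x = eval f x"
  shows "eval (D d e) x = eval (D d f) x"
proof -
  have "eval e = eval f" using assms by (simp add: fun_eq_iff)
  then have "(\<lambda>h. eval (D h e) x) = (\<lambda>h. eval (D h f) x)"
    using has_derivative_unique[OF eval_has_derivative[of e x]] eval_has_derivative[of f x] by simp
  then show ?thesis by (rule fun_cong)
qed

lemma eval_D_funpow: "eval (D d ((D d' ^^ k) e)) x = eval ((D d' ^^ k) (D d e)) x"
proof (induction k arbitrary: x)
  case (Suc k)
  have "eval (D d ((D d' ^^ Suc k) e)) x = eval (D d' (D d ((D d' ^^ k) e))) x"
    by (simp add: eval_D_commute)
  also have "\<dots> = eval (D d' ((D d' ^^ k) (D d e))) x"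
    by (rule eval_D_cong[OF Suc])
  finally show ?case by simp
qed simp

text \<open>
The witnesses are the iterated formal derivatives, first in direction \<open>(1, 0)\<close> and then in direction
\<open>(0, 1)\<close>; the only point is to commute one more derivative in the first direction past those in the
second one.
\<close>
lemma smooth_eval: "smooth (eval e)"
  unfolding smooth_def
proof -
  let ?D = "\<lambda>j k. eval ((D (0, 1) ^^ k) ((D (1, 0) ^^ j) e))"
  show "\<exists>D. D 0 0 = eval e \<and> (\<forall>j k x. (D j k has_derivative
        (\<lambda>h. of_real (fst h) * D (Suc j) k x + of_real (snd h) * D j (Suc k) x)) (at x))"
  proof (rule exI[of _ ?D], intro conjI allI)
  show "?D 0 0 = eval e" by simp
  fix j k x
  have "(?D j k has_derivative (\<lambda>h. eval (D h ((D (0, 1) ^^ k) ((D (1, 0) ^^ j) e))) x)) (at x)"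
    by (rule eval_has_derivative)
  then show "(?D j k has_derivative (\<lambda>h. of_real (fst h) * ?D (Suc j) k x + of_real (snd h) * ?D j (Suc k) x)) (at x)"
    by (subst (asm) eval_D_split) (simp add: eval_D_funpow)
  qed
qed

lemma continuous_on_eval: "continuous_on A (eval e)"
  by (meson continuous_at_imp_continuous_on eval_has_derivative has_derivative_continuous)

lemma borel_measurable_eval [measurable]: "eval e \<in> borel_measurable borel"
  by (intro borel_measurable_continuous_onI continuous_on_eval)

lemma frechet_derivative_eval: "frechet_derivative (eval e) (at x) d = eval (D d e) x"
  using frechet_derivative_at[OF eval_has_derivative[of e x]] by (rule fun_cong[symmetric])

lemma locally_integrable_continuous:
  assumes "continuous_on UNIV f"
  shows "locally_integrable f"
  unfolding locally_integrable_def set_integrable_def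
  by (auto intro!: borel_integrable_compact continuous_on_subset[OF assms])

text \<open>
A locally integrable function is the pointwise limit of its truncations to growing balls.
\<close>
lemma locally_integrable_measurable:
  assumes "locally_integrable f"
  shows "f \<in> borel_measurable borel"
proof (rule borel_measurable_LIMSEQ_metric)
  show "(\<lambda>x. indicator (cball 0 (real n)) x *\<^sub>R f x) \<in> borel_measurable borel" for n
    using assms unfolding locally_integrable_def set_integrable_def
    by (metis borel_measurable_integrable compact_cball measurable_lborel2)
  show "(\<lambda>n. indicator (cball 0 (real n)) x *\<^sub>R f x) \<longlonglongrightarrow> f x" for x
  proof (rule tendsto_eventually)
    obtain N where "norm x \<le> real N" using real_arch_simple by blast
    then show "\<forall>\<^sub>F n in sequentially. indicator (cball 0 (real n)) x *\<^sub>R f x = f x"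
      by (intro eventually_sequentiallyI[of N]) (auto simp: indicator_def)
  qed
qed

lemma eval_test_function:
  assumes "compact K" "\<And>x. x \<notin> K \<Longrightarrow> eval e x = 0"
  shows "eval e \<in> test_functions"
proof -
  have "{x. eval e x \<noteq> 0} \<subseteq> K" using assms by auto
  then have "closure {x. eval e x \<noteq> 0} \<subseteq> K"
    using assms(1) by (intro closure_minimal compact_imp_closed)
  then have "compact (closure {x. eval e x \<noteq> 0})"
    using assms(1) by (metis closed_closure compact_Int_closed inf.absorb_iff2)
  then show ?thesis by (simp add: test_functions_def smooth_eval)
qed

text \<open>
Supported in the square of side \<open>2 * n\<close> around the origin. As \<open>exp (- 1 / y)\<close> tends to 1 for large
\<open>y\<close>, shifting its zero to distance \<open>n\<close> is enough to make these functions converge to 1, with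
derivatives that are bounded uniformly in \<open>n\<close> and tend to 0.
\<close>
definition cutoff :: "nat \<Rightarrow> expr" where
  "cutoff n = Mul (Mul (Flat 0 1 0 (real n)) (Flat 0 (- 1) 0 (real n)))
     (Mul (Flat 0 0 1 (real n)) (Flat 0 0 (- 1) (real n)))"

lemma cutoff_eq_0:
  assumes "x \<notin> cbox (- real n, - real n) (real n, real n)"
  shows "eval (cutoff n) x = 0"
  using assms by (cases x) (auto simp: cutoff_def flat_def cbox_Pair_eq)

lemma norm_cutoff_le_1: "norm (eval (cutoff n) x) \<le> 1"
  unfolding cutoff_def
  by (auto simp: norm_mult flat_nonneg flat_0_le_1 intro!: mult_le_one mult_nonneg_nonneg)

lemma norm_D_cutoff_le: "norm (eval (D d (cutoff n)) x) \<le> 4 * (\<bar>fst d\<bar> + \<bar>snd d\<bar>)"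
proof -
  define f where "f m a b = flat m (a * fst x + b * snd x + real n)" for m a b
  have f: "0 \<le> f m a b" "f 0 a b \<le> 1" "f 2 a b \<le> 2" for m a b
    by (simp_all add: f_def flat_nonneg flat_0_le_1 flat_2_le_2)
  have ev: "eval (D d (cutoff n)) x = of_real (
      fst d * (f 2 1 0 * f 0 (- 1) 0 * (f 0 0 1 * f 0 0 (- 1)))
      - fst d * (f 0 1 0 * f 2 (- 1) 0 * (f 0 0 1 * f 0 0 (- 1)))
      + snd d * (f 0 1 0 * f 0 (- 1) 0 * (f 2 0 1 * f 0 0 (- 1)))
      - snd d * (f 0 1 0 * f 0 (- 1) 0 * (f 0 0 1 * f 2 0 (- 1))))"
    unfolding cutoff_def f_def by (simp add: algebra_simps numeral_2_eq_2)
  have p: "\<bar>s * t\<bar> \<le> 2 * \<bar>s\<bar>" if "t \<le> 2" "0 \<le> t" for s t :: real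
    using mult_left_mono[OF that(1), of "\<bar>s\<bar>"] that(2) by (simp add: abs_mult mult.commute)
  have b: "f i a1 b1 * f j a2 b2 * (f k a3 b3 * f l a4 b4) \<le> 2"
    if "i = 2 \<and> j = 0 \<and> k = 0 \<and> l = 0 \<or> i = 0 \<and> j = 2 \<and> k = 0 \<and> l = 0
      \<or> i = 0 \<and> j = 0 \<and> k = 2 \<and> l = 0 \<or> i = 0 \<and> j = 0 \<and> k = 0 \<and> l = 2" for i j k l a1 a2 a3 a4 b1 b2 b3 b4
  proof -
    have le: "u * v * (w * z) \<le> U * V * (W * Z)"
      if "0 \<le> u" "u \<le> U" "0 \<le> v" "v \<le> V" "0 \<le> w" "w \<le> W" "0 \<le> z" "z \<le> Z" for u v w z U V W Z :: real
      using that by (intro mult_mono mult_nonneg_nonneg) auto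
    let ?c = "\<lambda>i::nat. if i = 2 then 2 else 1 :: real"
    have "f i a1 b1 * f j a2 b2 * (f k a3 b3 * f l a4 b4) \<le> ?c i * ?c j * (?c k * ?c l)"
      using that f by (intro le) auto
    also have "\<dots> = 2" using that by auto
    finally show ?thesis .
  qed
  have nn: "0 \<le> f i a1 b1 * f j a2 b2 * (f k a3 b3 * f l a4 b4)" for i j k l a1 a2 a3 a4 b1 b2 b3 b4
    using f by simp
  have tri: "\<bar>a - b + c - e\<bar> \<le> 4 * (s + t)"
    if "\<bar>a\<bar> \<le> 2 * s" "\<bar>b\<bar> \<le> 2 * s" "\<bar>c\<bar> \<le> 2 * t" "\<bar>e\<bar> \<le> 2 * t" for a b c e s t :: real
    using that by (auto simp: abs_le_iff)
  show ?thesis unfolding ev norm_of_real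
    by (intro tri p b nn) auto
qed

lemma tendsto_flat_shift:
  "(\<lambda>n. flat m (t + real n)) \<longlonglongrightarrow> (if m = 0 then 1 else 0)"
proof (rule filterlim_compose[OF tendsto_flat_at_top])
  show "filterlim (\<lambda>n. t + real n) at_top sequentially"
    by (rule filterlim_tendsto_add_at_top[OF tendsto_const filterlim_real_sequentially])
qed

lemma tendsto_cutoff: "(\<lambda>n. eval (cutoff n) x) \<longlonglongrightarrow> 1"
  and tendsto_D_cutoff: "(\<lambda>n. eval (D d (cutoff n)) x) \<longlonglongrightarrow> 0"
proof -
  have f0: "(\<lambda>n. complex_of_real (flat 0 (t + real n))) \<longlonglongrightarrow> 1"
    and f2: "(\<lambda>n. complex_of_real (flat (Suc (Suc 0)) (t + real n))) \<longlonglongrightarrow> 0" for t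
    using tendsto_of_real[OF tendsto_flat_shift[of 0 t]]
      tendsto_of_real[OF tendsto_flat_shift[of "Suc (Suc 0)" t]] by simp_all
  let ?f = "\<lambda>m a b n. complex_of_real (flat m (a * fst x + b * snd x + real n))"
  have "(\<lambda>n. ?f 0 1 0 n * ?f 0 (- 1) 0 n * (?f 0 0 1 n * ?f 0 0 (- 1) n)) \<longlonglongrightarrow> 1 * 1 * (1 * 1)"
    by (intro tendsto_mult f0)
  then show "(\<lambda>n. eval (cutoff n) x) \<longlonglongrightarrow> 1"
    by (simp add: cutoff_def)
  let ?g = "\<lambda>a b n. of_real (a * fst d + b * snd d) * (?f (Suc (Suc 0)) a b n + - of_nat 0 * ?f (Suc 0) a b n)"
  have g: "(\<lambda>n. ?g a b n) \<longlonglongrightarrow> 0" for a b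
    using tendsto_mult[OF tendsto_const f2] by simp
  have "(\<lambda>n. (?g 1 0 n * ?f 0 (- 1) 0 n + ?f 0 1 0 n * ?g (- 1) 0 n) * (?f 0 0 1 n * ?f 0 0 (- 1) n)
      + ?f 0 1 0 n * ?f 0 (- 1) 0 n * (?g 0 1 n * ?f 0 0 (- 1) n + ?f 0 0 1 n * ?g 0 (- 1) n))
    \<longlonglongrightarrow> (0 * 1 + 1 * 0) * (1 * 1) + 1 * 1 * (0 * 1 + 1 * 0)"
    by (intro tendsto_mult tendsto_add f0 g)
  then show "(\<lambda>n. eval (D d (cutoff n)) x) \<longlonglongrightarrow> 0"
    by (simp add: cutoff_def)
qed

section \<open>Weak derivatives\<close>

lemma integral_derivative_compact_support:
  fixes f g :: "real \<Rightarrow> complex"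
  assumes deriv: "\<And>t. (f has_vector_derivative g t) (at t)" and cont: "continuous_on UNIV g"
    and zero: "\<And>t. \<bar>t\<bar> \<ge> R \<Longrightarrow> f t = 0" "\<And>t. \<bar>t\<bar> \<ge> R \<Longrightarrow> g t = 0" and R: "R > 0"
  shows "(\<integral>t. g t \<partial>lborel) = 0"
proof -
  have "(\<integral>t. g t \<partial>lborel) = (\<integral>t. indicator {- R..R} t *\<^sub>R g t \<partial>lborel)"
    using zero(2) by (intro Bochner_Integration.integral_cong) (auto simp: indicator_def)
  also have "\<dots> = f R - f (- R)"
    using R by (intro integral_FTC_Icc has_vector_derivative_at_within[OF deriv] continuous_on_subset[OF cont]) auto
  also have "\<dots> = 0" using zero(1) R by simp
  finally show ?thesis .
qed

text \<open>
Fubini's theorem reduces this to the fundamental theorem of calculus on lines parallel to \<open>e\<close>.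
\<close>
lemma integral_partial_derivative_compact_support:
  fixes F :: "plane \<Rightarrow> complex"
  assumes deriv: "\<And>x. (F has_derivative F' x) (at x)" and cont: "continuous_on UNIV (\<lambda>x. F' x e)"
    and supp: "compact K" "\<And>x. x \<notin> K \<Longrightarrow> F x = 0" "\<And>x. x \<notin> K \<Longrightarrow> F' x e = 0"
    and e: "e \<in> {(1, 0), (0, 1)}"
  shows "(\<integral>x. F' x e \<partial>lborel) = 0"
proof -
  have "(\<lambda>x. indicator K x *\<^sub>R F' x e) = (\<lambda>x. F' x e)"
    using supp(3) by (auto simp: indicator_def fun_eq_iff)
  then have int: "integrable (lborel \<Otimes>\<^sub>M lborel) (\<lambda>x. F' x e)"
    using borel_integrable_compact[OF supp(1) continuous_on_subset[OF cont]] by (simp add: lborel_prod)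
  obtain R where R: "R > 0" "\<And>x. x \<in> K \<Longrightarrow> norm x < R"
    using bounded_pos_less compact_imp_bounded[OF supp(1)] by metis
  have out: "F (s, t) = 0" "F' (s, t) e = 0" if "\<bar>s\<bar> \<ge> R \<or> \<bar>t\<bar> \<ge> R" for s t
  proof -
    have "(s, t) \<notin> K"
    proof
      assume "(s, t) \<in> K"
      then have "norm (s, t) < R" by (rule R(2))
      moreover have "norm (fst (s, t)) \<le> norm (s, t)" "norm (snd (s, t)) \<le> norm (s, t)"
        using norm_fst_le[of s t] norm_snd_le[of t s] by auto
      ultimately show False using that by auto
    qed
    then show "F (s, t) = 0" "F' (s, t) e = 0" using supp by auto
  qed
  consider "e = (1, 0)" | "e = (0, 1)" using e by auto
  then show ?thesis
  proof cases
    case 1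
    have "(\<integral>s. F' (s, t) e \<partial>lborel) = 0" for t
    proof (rule integral_derivative_compact_support[where f = "\<lambda>s. F (s, t)" and R = R])
      show "((\<lambda>s. F (s, t)) has_vector_derivative F' (s, t) e) (at s)" for s
      proof -
        have "((\<lambda>s. (s, t)) has_derivative (\<lambda>h. (h, 0))) (at s)"
          by (auto intro!: derivative_eq_intros)
        from has_derivative_compose[OF this deriv]
        have "((\<lambda>s. F (s, t)) has_derivative (\<lambda>h. F' (s, t) (h, 0))) (at s)" .
        moreover have "F' (s, t) (h, 0) = h *\<^sub>R F' (s, t) e" for h
          using linear_scale[OF has_derivative_linear[OF deriv[of "(s, t)"]], of h e] 1 by simp
        ultimately show ?thesis by (simp add: has_vector_derivative_def)
      qed
    qed (use R out in \<open>auto intro!: continuous_on_compose2[OF cont] continuous_intros\<close>)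
    then show ?thesis using lborel_pair.integral_snd[of "\<lambda>s t. F' (s, t) e"] int
      by (simp add: lborel_prod case_prod_unfold)
  next
    case 2
    have "(\<integral>t. F' (s, t) e \<partial>lborel) = 0" for s
    proof (rule integral_derivative_compact_support[where f = "\<lambda>t. F (s, t)" and R = R])
      show "((\<lambda>t. F (s, t)) has_vector_derivative F' (s, t) e) (at t)" for t
      proof -
        have "((\<lambda>t. (s, t)) has_derivative (\<lambda>h. (0, h))) (at t)"
          by (auto intro!: derivative_eq_intros)
        from has_derivative_compose[OF this deriv]
        have "((\<lambda>t. F (s, t)) has_derivative (\<lambda>h. F' (s, t) (0, h))) (at t)" .
        moreover have "F' (s, t) (0, h) = h *\<^sub>R F' (s, t) e" for h
          using linear_scale[OF has_derivative_linear[OF deriv[of "(s, t)"]], of h e] 2 by simp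
        ultimately show ?thesis by (simp add: has_vector_derivative_def)
      qed
    qed (use R out in \<open>auto intro!: continuous_on_compose2[OF cont] continuous_intros\<close>)
    then show ?thesis using lborel_pair.integral_fst'[OF int]
      by (simp add: lborel_prod)
  qed
qed

lemma test_function_derivative:
  assumes "\<phi> \<in> test_functions"
  obtains \<phi>' K where "\<And>x. (\<phi> has_derivative \<phi>' x) (at x)" "\<And>e. continuous_on UNIV (\<lambda>x. \<phi>' x e)"
    "\<And>x. \<phi>' x = frechet_derivative \<phi> (at x)" "compact K"
    "\<And>x. x \<notin> K \<Longrightarrow> \<phi> x = 0" "\<And>x e. x \<notin> K \<Longrightarrow> \<phi>' x e = 0"
proof -
  from assms obtain D where D0: "D 0 0 = \<phi>" and D: "\<And>j k x. (D j k has_derivative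
        (\<lambda>h. of_real (fst h) * D (Suc j) k x + of_real (snd h) * D j (Suc k) x)) (at x)"
    unfolding test_functions_def smooth_def by blast
  define \<phi>' where "\<phi>' x h = of_real (fst h) * D 1 0 x + of_real (snd h) * D 0 1 x" for x h :: plane
  define K where "K = closure {x. \<phi> x \<noteq> 0}"
  have deriv: "(\<phi> has_derivative \<phi>' x) (at x)" for x
    using D[of 0 0 x] by (simp add: D0 \<phi>'_def[abs_def])
  have contD: "continuous_on UNIV (D j k)" for j k
    by (meson continuous_at_imp_continuous_on D has_derivative_continuous)
  have zero: "\<phi> x = 0" if "x \<notin> K" for x
    using that closure_subset[of "{x. \<phi> x \<noteq> 0}"] by (auto simp: K_def)
  show ?thesis
  proof (rule that[OF deriv _ _ _ zero])
    show "continuous_on UNIV (\<lambda>x. \<phi>' x e)" for e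
      unfolding \<phi>'_def by (intro continuous_intros contD)
    show "\<phi>' x = frechet_derivative \<phi> (at x)" for x
      by (rule frechet_derivative_at[OF deriv])
    show "compact K" using assms by (simp add: test_functions_def K_def)
    show "\<phi>' x e = 0" if "x \<notin> K" for x e
    proof -
      have "open (- K)" by (simp add: K_def open_Compl)
      then have "((\<lambda>_. 0) has_derivative \<phi>' x) (at x)"
        using that zero by (intro has_derivative_transform_within_open[OF deriv]) auto
      from has_derivative_unique[OF this has_derivative_const] show ?thesis by (rule fun_cong)
    qed
  qed
qed

text \<open>
For a test function \<open>\<phi>\<close> the product \<open>eval f * \<phi>\<close> has compact support, so the integral of its
derivative vanishes, and the product rule gives the claim.
\<close>
lemma eval_has_weak_derivative:
  assumes e: "e \<in> {(1, 0), (0, 1)}"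
  shows "has_weak_derivative e (eval f) (eval (D e f))"
  unfolding has_weak_derivative_def
proof (intro conjI ballI)
  show "locally_integrable (eval f)" "locally_integrable (eval (D e f))"
    by (intro locally_integrable_continuous continuous_on_eval)+
  fix \<phi> assume "\<phi> \<in> test_functions"
  then obtain \<phi>' K where \<phi>: "\<And>x. (\<phi> has_derivative \<phi>' x) (at x)" "\<And>e. continuous_on UNIV (\<lambda>x. \<phi>' x e)"
    "\<And>x. \<phi>' x = frechet_derivative \<phi> (at x)" "compact K"
    "\<And>x. x \<notin> K \<Longrightarrow> \<phi> x = 0" "\<And>x e. x \<notin> K \<Longrightarrow> \<phi>' x e = 0"
    by (rule test_function_derivative) blast
  have cont\<phi>: "continuous_on UNIV \<phi>"
    by (meson continuous_at_imp_continuous_on \<phi>(1) has_derivative_continuous)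
  have int: "integrable lborel (\<lambda>x. eval f x * \<phi>' x e)" "integrable lborel (\<lambda>x. eval (D e f) x * \<phi> x)"
  proof -
    have "(\<lambda>x. indicator K x *\<^sub>R (eval f x * \<phi>' x e)) = (\<lambda>x. eval f x * \<phi>' x e)"
         "(\<lambda>x. indicator K x *\<^sub>R (eval (D e f) x * \<phi> x)) = (\<lambda>x. eval (D e f) x * \<phi> x)"
      using \<phi>(5,6) by (auto simp: indicator_def fun_eq_iff)
    moreover have "integrable lborel (\<lambda>x. indicator K x *\<^sub>R (eval f x * \<phi>' x e))"
        "integrable lborel (\<lambda>x. indicator K x *\<^sub>R (eval (D e f) x * \<phi> x))"
      by (intro borel_integrable_compact \<phi>(4) continuous_intros continuous_on_eval
          continuous_on_subset[OF \<phi>(2)] continuous_on_subset[OF cont\<phi>] subset_UNIV)+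
    ultimately show "integrable lborel (\<lambda>x. eval f x * \<phi>' x e)" "integrable lborel (\<lambda>x. eval (D e f) x * \<phi> x)"
      by simp_all
  qed
  have "(\<integral>x. eval f x * \<phi>' x e + eval (D e f) x * \<phi> x \<partial>lborel) = 0"
  proof (rule integral_partial_derivative_compact_support[where F = "\<lambda>x. eval f x * \<phi> x" and
      F' = "\<lambda>x h. eval f x * \<phi>' x h + eval (D h f) x * \<phi> x" and K = K, OF _ _ \<phi>(4) _ _ e])
    show "((\<lambda>x. eval f x * \<phi> x) has_derivative (\<lambda>h. eval f x * \<phi>' x h + eval (D h f) x * \<phi> x)) (at x)" for x
      by (rule has_derivative_mult[OF eval_has_derivative \<phi>(1)])
    show "continuous_on UNIV (\<lambda>x. eval f x * \<phi>' x e + eval (D e f) x * \<phi> x)"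
      by (intro continuous_intros continuous_on_eval \<phi>(2) cont\<phi>)
  qed (use \<phi> in auto)
  then show "(\<integral>x. eval f x * frechet_derivative \<phi> (at x) e \<partial>lborel) = - (\<integral>x. eval (D e f) x * \<phi> x \<partial>lborel)"
    using int by (simp add: \<phi>(3) eq_neg_iff_add_eq_0)
qed

text \<open>
The positive and the negative part of \<open>k\<close> are densities of two measures that agree and are finite on
all open boxes, which form a generator stable under intersections.
\<close>
lemma AE_eq_0_if_box_integrals_eq_0:
  fixes k :: "plane \<Rightarrow> real"
  assumes meas[measurable]: "k \<in> borel_measurable borel"
    and int: "\<And>l u. integrable lborel (\<lambda>x. indicator (box l u) x *\<^sub>R k x)"
    and zero: "\<And>l u. (\<integral>x. indicator (box l u) x *\<^sub>R k x \<partial>lborel) = 0"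
  shows "AE x in lborel. k x = 0"
proof -
  let ?P = "density lborel (\<lambda>x. ennreal (k x))"
  let ?N = "density lborel (\<lambda>x. ennreal (- k x))"
  have em: "emeasure (density lborel (\<lambda>x. ennreal (s * k x))) (box l u)
      = ennreal (\<integral>x. max 0 (s * (indicator (box l u) x *\<^sub>R k x)) \<partial>lborel)" for l u s
  proof -
    have "emeasure (density lborel (\<lambda>x. ennreal (s * k x))) (box l u)
        = (\<integral>\<^sup>+x. ennreal (max 0 (s * (indicator (box l u) x *\<^sub>R k x))) \<partial>lborel)"
      by (subst emeasure_density) (auto intro!: nn_integral_cong simp: indicator_def max_def ennreal_neg)
    also have "\<dots> = ennreal (\<integral>x. max 0 (s * (indicator (box l u) x *\<^sub>R k x)) \<partial>lborel)"
      by (intro nn_integral_eq_integral integrable_max integrable_mult_right int) auto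
    finally show ?thesis .
  qed
  have P: "emeasure ?P (box l u) = ennreal (\<integral>x. max 0 (indicator (box l u) x *\<^sub>R k x) \<partial>lborel)"
    and N: "emeasure ?N (box l u) = ennreal (\<integral>x. max 0 (- (indicator (box l u) x *\<^sub>R k x)) \<partial>lborel)" for l u
    using em[of 1 l u] em[of "- 1" l u] by simp_all
  have eq: "(\<integral>x. max 0 (indicator (box l u) x *\<^sub>R k x) \<partial>lborel) = (\<integral>x. max 0 (- (indicator (box l u) x *\<^sub>R k x)) \<partial>lborel)" for l u
  proof -
    have "(\<integral>x. max 0 (indicator (box l u) x *\<^sub>R k x) \<partial>lborel) - (\<integral>x. max 0 (- (indicator (box l u) x *\<^sub>R k x)) \<partial>lborel)
      = (\<integral>x. max 0 (indicator (box l u) x *\<^sub>R k x) - max 0 (- (indicator (box l u) x *\<^sub>R k x)) \<partial>lborel)"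
      by (intro Bochner_Integration.integral_diff[symmetric] integrable_max integrable_minus int) auto
    also have "\<dots> = (\<integral>x. indicator (box l u) x *\<^sub>R k x \<partial>lborel)"
      by (intro Bochner_Integration.integral_cong) auto
    finally show ?thesis using zero by simp
  qed
  have "?P = ?N"
  proof (rule measure_eqI_generator_eq)
    let ?E = "range (\<lambda>(a, b). box a b :: plane set)"
    show "Int_stable ?E"
      by (auto simp: Int_stable_def box_Int_box)
    show "?E \<subseteq> Pow UNIV" "sets ?P = sigma_sets UNIV ?E" "sets ?N = sigma_sets UNIV ?E"
      by (simp_all add: borel_eq_box)
    let ?A = "\<lambda>n::nat. box (- (real n *\<^sub>R One)) (real n *\<^sub>R One) :: plane set"
    show "range ?A \<subseteq> ?E" "(\<Union>i. ?A i) = UNIV"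
      unfolding UN_box_eq_UNIV by auto
    show "emeasure ?P (?A i) \<noteq> \<infinity>" for i unfolding P by simp
    show "emeasure ?P X = emeasure ?N X" if "X \<in> ?E" for X
      using that by (auto simp only: P N eq split: prod.splits)
  qed
  then have "AE x in lborel. ennreal (k x) = ennreal (- k x)"
    by (intro sigma_finite_measure.density_unique[OF lborel.sigma_finite_measure_axioms]) auto
  then show ?thesis
    by eventually_elim (metis ennreal_eq_0_iff ennreal_neg le_cases neg_0_le_iff_le neg_le_0_iff_le order_antisym)
qed

text \<open>
Smooth functions supported in the closed box that increase to the indicator of the open box: each
factor is \<open>exp (- 1 / (n * t))\<close>, where \<open>t\<close> is the distance to one side of the box.
\<close>
definition box_approx :: "plane \<Rightarrow> plane \<Rightarrow> nat \<Rightarrow> expr" where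
  "box_approx l u n = Mul (Mul (Flat 0 n 0 (- n * fst l)) (Flat 0 (- n) 0 (n * fst u)))
     (Mul (Flat 0 0 n (- n * snd l)) (Flat 0 0 (- n) (n * snd u)))"

lemma box_approx_eq_0:
  assumes "x \<notin> box l u"
  shows "eval (box_approx l u n) x = 0"
proof -
  have "flat 0 (real n * s - real n * a) = 0" if "\<not> a < s" for s a
    using that mult_left_mono[of s a "real n"] by (simp add: flat_def)
  then have f: "flat 0 (real n * s + - (real n * a)) = 0" "flat 0 (- (real n * a) + real n * s) = 0" if "\<not> a < s" for s a
    using that by (simp_all add: algebra_simps)
  have "x \<in> box l u \<longleftrightarrow> (fst l < fst x \<and> fst x < fst u) \<and> (snd l < snd x \<and> snd x < snd u)"
    by (auto simp: mem_box Basis_prod_def inner_prod_def)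
  then show ?thesis using assms f by (auto simp: box_approx_def)
qed

lemma norm_box_approx_le_1: "norm (eval (box_approx l u n) x) \<le> 1"
  unfolding box_approx_def
  by (auto simp: norm_mult flat_nonneg flat_0_le_1 intro!: mult_le_one mult_nonneg_nonneg)

lemma tendsto_box_approx:
  "(\<lambda>n. eval (box_approx l u n) x) \<longlonglongrightarrow> indicator (box l u) x"
proof (cases "x \<in> box l u")
  case False
  then show ?thesis by (simp add: box_approx_eq_0)
next
  case True
  have f: "(\<lambda>n. complex_of_real (flat 0 (real n * d))) \<longlonglongrightarrow> 1" if "d > 0" for d
  proof -
    have "filterlim (\<lambda>n. real n * d) at_top sequentially"
      using that by (intro filterlim_at_top_mult_tendsto_pos[OF tendsto_const _ filterlim_real_sequentially])
    then show ?thesis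
      using tendsto_of_real[OF filterlim_compose[OF tendsto_flat_at_top[of 0]]] by simp
  qed
  have b: "fst l < fst x \<and> fst x < fst u" "snd l < snd x \<and> snd x < snd u"
    using True by (auto simp: mem_box Basis_prod_def inner_prod_def)
  have "(\<lambda>n. complex_of_real (flat 0 (real n * (fst x - fst l))) * of_real (flat 0 (real n * (fst u - fst x))) *
     (of_real (flat 0 (real n * (snd x - snd l))) * of_real (flat 0 (real n * (snd u - snd x))))) \<longlonglongrightarrow> 1 * 1 * (1 * 1)"
    using b by (intro tendsto_mult f) auto
  then show ?thesis using True by (simp add: box_approx_def algebra_simps)
qed

text \<open>
The fundamental lemma of the calculus of variations: by dominated convergence the functions
\<open>box_approx\<close> carry the vanishing over to integrals over boxes.
\<close>
lemma AE_eq_0_if_orthogonal_to_test_functions: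
  assumes loc: "locally_integrable h"
    and zero: "\<And>\<phi>. \<phi> \<in> test_functions \<Longrightarrow> (\<integral>x. h x * \<phi> x \<partial>lborel) = 0"
  shows "AE x in lborel. h x = 0"
proof -
  have meas[measurable]: "h \<in> borel_measurable borel"
    using loc by (rule locally_integrable_measurable)
  have intc: "integrable lborel (\<lambda>x. indicator (cbox l u) x *\<^sub>R h x)" for l u
    using loc by (auto simp: locally_integrable_def set_integrable_def)
  have int: "integrable lborel (\<lambda>x. indicator (box l u) x *\<^sub>R h x)" for l u
    using box_subset_cbox[of l u]
    by (intro Bochner_Integration.integrable_bound[OF intc[of l u]]) (auto simp: indicator_def)
  have box0: "(\<integral>x. indicator (box l u) x *\<^sub>R h x \<partial>lborel) = 0" for l u
  proof -
    have "(\<lambda>n. \<integral>x. h x * eval (box_approx l u n) x \<partial>lborel) \<longlonglongrightarrow> (\<integral>x. indicator (box l u) x *\<^sub>R h x \<partial>lborel)"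
    proof (rule integral_dominated_convergence)
      show "integrable lborel (\<lambda>x. norm (indicator (box l u) x *\<^sub>R h x))"
        using int by (rule integrable_norm)
      show "AE x in lborel. (\<lambda>n. h x * eval (box_approx l u n) x) \<longlonglongrightarrow> indicator (box l u) x *\<^sub>R h x"
      proof (rule AE_I2)
        fix x
        have "(\<lambda>n. h x * eval (box_approx l u n) x) \<longlonglongrightarrow> h x * indicator (box l u) x"
          by (intro tendsto_intros tendsto_box_approx)
        moreover have "h x * indicator (box l u) x = indicator (box l u) x *\<^sub>R h x"
          by (simp add: indicator_def)
        ultimately show "(\<lambda>n. h x * eval (box_approx l u n) x) \<longlonglongrightarrow> indicator (box l u) x *\<^sub>R h x"
          by simp
      qed
      show "AE x in lborel. norm (h x * eval (box_approx l u n) x) \<le> norm (indicator (box l u) x *\<^sub>R h x)" for n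
      proof (rule AE_I2)
        fix x
        show "norm (h x * eval (box_approx l u n) x) \<le> norm (indicator (box l u) x *\<^sub>R h x)"
          using mult_left_mono[OF norm_box_approx_le_1[of l u n x], of "norm (h x)"] box_approx_eq_0[of x l u n]
          by (cases "x \<in> box l u") (auto simp: norm_mult)
      qed
    qed auto
    moreover have "eval (box_approx l u n) \<in> test_functions" for n
      using box_subset_cbox[of l u]
      by (intro eval_test_function[of "cbox l u"]) (auto intro: box_approx_eq_0)
    then have "(\<integral>x. h x * eval (box_approx l u n) x \<partial>lborel) = 0" for n
      by (rule zero)
    ultimately show ?thesis by (simp add: LIMSEQ_const_iff)
  qed
  have "AE x in lborel. Re (h x) = 0"
    by (rule AE_eq_0_if_box_integrals_eq_0)
       (use integrable_Re[OF int] integral_Re[OF int] box0 in \<open>auto\<close>)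
  moreover have "AE x in lborel. Im (h x) = 0"
    by (rule AE_eq_0_if_box_integrals_eq_0)
       (use integrable_Im[OF int] integral_Im[OF int] box0 in \<open>auto\<close>)
  ultimately show ?thesis by eventually_elim (simp add: complex_eq_iff)
qed

lemma weak_derivative_unique:
  assumes "has_weak_derivative e u g" "has_weak_derivative e u g'"
  shows "AE x in lborel. g x = g' x"
proof -
  have loc: "locally_integrable g" "locally_integrable g'"
    using assms by (auto simp: has_weak_derivative_def)
  have "AE x in lborel. g x - g' x = 0"
  proof (rule AE_eq_0_if_orthogonal_to_test_functions)
    show "locally_integrable (\<lambda>x. g x - g' x)"
      using loc unfolding locally_integrable_def by auto
    fix \<phi> assume \<phi>: "\<phi> \<in> test_functions"
    then obtain \<phi>' K where K: "\<And>x. (\<phi> has_derivative \<phi>' x) (at x)" "compact K" "\<And>x. x \<notin> K \<Longrightarrow> \<phi> x = 0"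
      by (rule test_function_derivative) blast
    have cont: "continuous_on UNIV \<phi>"
      by (meson continuous_at_imp_continuous_on K(1) has_derivative_continuous)
    have [measurable]: "\<phi> \<in> borel_measurable borel"
      using cont by (rule borel_measurable_continuous_onI)
    obtain M where M: "\<And>x. x \<in> K \<Longrightarrow> norm (\<phi> x) \<le> M"
      using compact_imp_bounded[OF compact_continuous_image[OF continuous_on_subset[OF cont] K(2)]]
      by (auto simp: bounded_iff)
    have int: "integrable lborel (\<lambda>x. f x * \<phi> x)" if f: "locally_integrable f" for f
    proof (rule Bochner_Integration.integrable_bound)
      have "integrable lborel (\<lambda>x. indicator K x *\<^sub>R f x)"
        using f K(2) by (simp add: locally_integrable_def set_integrable_def)
      then show "integrable lborel (\<lambda>x. M *\<^sub>R (indicator K x *\<^sub>R f x))"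
        by (rule integrable_scaleR_right)
      have [measurable]: "f \<in> borel_measurable borel"
        using f by (rule locally_integrable_measurable)
      show "(\<lambda>x. f x * \<phi> x) \<in> borel_measurable lborel" by simp
      show "AE x in lborel. norm (f x * \<phi> x) \<le> norm (M *\<^sub>R (indicator K x *\<^sub>R f x))"
      proof (rule AE_I2)
        fix x
        show "norm (f x * \<phi> x) \<le> norm (M *\<^sub>R (indicator K x *\<^sub>R f x))"
        proof (cases "x \<in> K")
          case True
          then have "norm (\<phi> x) \<le> \<bar>M\<bar>" using M[of x] by linarith
          then show ?thesis using True by (simp add: norm_mult mult.commute mult_right_mono)
        qed (simp add: K(3))
      qed
    qed
    have "(\<integral>x. g x * \<phi> x \<partial>lborel) = (\<integral>x. g' x * \<phi> x \<partial>lborel)"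
    proof -
      have "- (\<integral>x. g x * \<phi> x \<partial>lborel) = (\<integral>x. u x * frechet_derivative \<phi> (at x) e \<partial>lborel)"
        using assms(1) \<phi> by (simp add: has_weak_derivative_def)
      also have "\<dots> = - (\<integral>x. g' x * \<phi> x \<partial>lborel)"
        using assms(2) \<phi> by (simp add: has_weak_derivative_def)
      finally show ?thesis by simp
    qed
    then show "(\<integral>x. (g x - g' x) * \<phi> x \<partial>lborel) = 0"
      using int[OF loc(1)] int[OF loc(2)] by (simp add: left_diff_distrib)
  qed
  then show ?thesis by simp
qed

text \<open>
Partial integration against functions \<open>h\<close> that need not have compact support, as long as all the
products involved are integrable. It follows from the case of the test functions \<open>h * cutoff n\<close> by
dominated convergence.
\<close>
lemma weak_derivative_parts:
  assumes weak: "has_weak_derivative e u g"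
    and int: "integrable lborel (\<lambda>x. u x * eval h x)" "integrable lborel (\<lambda>x. u x * eval (D e h) x)"
      "integrable lborel (\<lambda>x. g x * eval h x)"
  shows "(\<integral>x. u x * eval (D e h) x \<partial>lborel) = - (\<integral>x. g x * eval h x \<partial>lborel)"
proof -
  have [measurable]: "u \<in> borel_measurable borel" "g \<in> borel_measurable borel"
    using weak by (auto simp: has_weak_derivative_def intro: locally_integrable_measurable)
  let ?h = "\<lambda>n. Mul h (cutoff n)"
  let ?C = "4 * (\<bar>fst e\<bar> + \<bar>snd e\<bar>)"
  have eq: "(\<integral>x. u x * eval (D e (?h n)) x \<partial>lborel) = - (\<integral>x. g x * eval (?h n) x \<partial>lborel)" for n
  proof -
    have "eval (?h n) \<in> test_functions"
      by (rule eval_test_function[of "cbox (- real n, - real n) (real n, real n)"]) (auto simp: cutoff_eq_0)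
    moreover have "\<forall>\<phi>\<in>test_functions.
        (\<integral>x. u x * frechet_derivative \<phi> (at x) e \<partial>lborel) = - (\<integral>x. g x * \<phi> x \<partial>lborel)"
      using weak by (simp add: has_weak_derivative_def)
    ultimately have "(\<integral>x. u x * frechet_derivative (eval (?h n)) (at x) e \<partial>lborel) = - (\<integral>x. g x * eval (?h n) x \<partial>lborel)"
      by (rule bspec[rotated])
    then show ?thesis by (simp only: frechet_derivative_eval)
  qed
  have lim: "(\<lambda>n. \<integral>x. u x * eval (D e (?h n)) x \<partial>lborel) \<longlonglongrightarrow> (\<integral>x. u x * eval (D e h) x \<partial>lborel)"
  proof (rule integral_dominated_convergence)
    show "integrable lborel (\<lambda>x. norm (u x * eval (D e h) x) + ?C * norm (u x * eval h x))"
      using int by (intro Bochner_Integration.integrable_add integrable_norm integrable_mult_right)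
    show "AE x in lborel. (\<lambda>n. u x * eval (D e (?h n)) x) \<longlonglongrightarrow> u x * eval (D e h) x"
    proof (rule AE_I2)
      fix x
      have "(\<lambda>n. u x * (eval (D e h) x * eval (cutoff n) x + eval h x * eval (D e (cutoff n)) x))
          \<longlonglongrightarrow> u x * (eval (D e h) x * 1 + eval h x * 0)"
        by (intro tendsto_intros tendsto_cutoff tendsto_D_cutoff)
      then show "(\<lambda>n. u x * eval (D e (?h n)) x) \<longlonglongrightarrow> u x * eval (D e h) x" by simp
    qed
    show "AE x in lborel. norm (u x * eval (D e (?h n)) x)
        \<le> norm (u x * eval (D e h) x) + ?C * norm (u x * eval h x)" for n
    proof (rule AE_I2)
      fix x
      have "norm (u x * eval (D e (?h n)) x)
        = norm ((u x * eval (D e h) x) * eval (cutoff n) x + (u x * eval h x) * eval (D e (cutoff n)) x)"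
        by (simp add: algebra_simps)
      also have "\<dots> \<le> norm (u x * eval (D e h) x) * norm (eval (cutoff n) x)
          + norm (u x * eval h x) * norm (eval (D e (cutoff n)) x)"
        unfolding norm_mult[symmetric] by (rule norm_triangle_ineq)
      also have "\<dots> \<le> norm (u x * eval (D e h) x) * 1 + norm (u x * eval h x) * ?C"
        by (intro add_mono mult_left_mono norm_cutoff_le_1 norm_D_cutoff_le norm_ge_zero)
      finally show "norm (u x * eval (D e (?h n)) x)
        \<le> norm (u x * eval (D e h) x) + ?C * norm (u x * eval h x)" by (simp add: mult.commute)
    qed
  qed simp_all
  have lim': "(\<lambda>n. \<integral>x. g x * eval (?h n) x \<partial>lborel) \<longlonglongrightarrow> (\<integral>x. g x * eval h x \<partial>lborel)"
  proof (rule integral_dominated_convergence)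
    show "integrable lborel (\<lambda>x. norm (g x * eval h x))" using int by simp
    show "AE x in lborel. (\<lambda>n. g x * eval (?h n) x) \<longlonglongrightarrow> g x * eval h x"
    proof (rule AE_I2)
      fix x
      have "(\<lambda>n. g x * (eval h x * eval (cutoff n) x)) \<longlonglongrightarrow> g x * (eval h x * 1)"
        by (intro tendsto_intros tendsto_cutoff)
      then show "(\<lambda>n. g x * eval (?h n) x) \<longlonglongrightarrow> g x * eval h x" by simp
    qed
    show "AE x in lborel. norm (g x * eval (?h n) x) \<le> norm (g x * eval h x)" for n
    proof (rule AE_I2)
      fix x
      show "norm (g x * eval (?h n) x) \<le> norm (g x * eval h x)"
        using mult_left_mono[OF norm_cutoff_le_1[of n x] norm_ge_zero[of "g x * eval h x"]]
        by (simp add: norm_mult mult.assoc)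
    qed
  qed simp_all
  show ?thesis
    by (rule LIMSEQ_unique[OF lim[unfolded eq] tendsto_minus[OF lim']])
qed

section \<open>Polynomial growth and square integrability\<close>

primrec is_poly :: "expr \<Rightarrow> bool" where
  "is_poly (Const c) = True"
| "is_poly X1 = True"
| "is_poly X2 = True"
| "is_poly (Add e f) = (is_poly e \<and> is_poly f)"
| "is_poly (Mul e f) = (is_poly e \<and> is_poly f)"
| "is_poly (Exp e) = False"
| "is_poly (Flat m p q r) = False"

primrec Pow :: "expr \<Rightarrow> nat \<Rightarrow> expr" where
  "Pow e 0 = Const 1"
| "Pow e (Suc n) = Mul e (Pow e n)"

lemma eval_Pow [simp]: "eval (Pow e n) x = eval e x ^ n"
  by (induction n) auto

lemma is_poly_Pow [simp]: "is_poly e \<Longrightarrow> is_poly (Pow e n)"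
  by (induction n) auto

lemma is_poly_D [simp]: "is_poly e \<Longrightarrow> is_poly (D d e)"
  by (induction e) auto

lemma eval_D_Pow: "eval (D d (Pow e n)) x = of_nat n * eval e x ^ (n - 1) * eval (D d e) x"
proof (induction n)
  case (Suc n)
  then show ?case by (cases n) (auto simp: algebra_simps)
qed simp

lemma eval_D_D_Pow:
  assumes "\<And>x. eval (D d (D d e)) x = 0"
  shows "eval (D d (D d (Pow e n))) x = of_nat n * of_nat (n - 1) * eval e x ^ (n - 2) * (eval (D d e) x)\<^sup>2"
proof -
  have "eval (D d (D d (Pow e n))) x = eval (D d (Mul (Const (of_nat n)) (Mul (Pow e (n - 1)) (D d e)))) x"
    by (rule eval_D_cong) (simp add: eval_D_Pow)
  also have "\<dots> = of_nat n * of_nat (n - 1) * eval e x ^ (n - 2) * (eval (D d e) x)\<^sup>2"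
    by (simp add: eval_D_Pow assms power2_eq_square numeral_2_eq_2)
  finally show ?thesis .
qed

lemma is_poly_growth:
  assumes "is_poly p"
  shows "\<exists>C\<ge>0. \<exists>c::nat. \<forall>x. norm (eval p x) \<le> C * exp (real c * (\<bar>fst x\<bar> + \<bar>snd x\<bar>))"
  using assms
proof (induction p)
  case (Const z)
  show ?case by (intro exI[of _ "norm z"] exI[of _ "0::nat"] conjI) auto
next
  case X1
  have "\<bar>fst x\<bar> \<le> exp (\<bar>fst x\<bar> + \<bar>snd x\<bar>)" for x :: plane
    using exp_ge_add_one_self[of "\<bar>fst x\<bar> + \<bar>snd x\<bar>"] by linarith
  then show ?case by (intro exI[of _ "1::real"] exI[of _ "1::nat"] conjI) auto
next
  case X2
  have "\<bar>snd x\<bar> \<le> exp (\<bar>fst x\<bar> + \<bar>snd x\<bar>)" for x :: plane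
    using exp_ge_add_one_self[of "\<bar>fst x\<bar> + \<bar>snd x\<bar>"] by linarith
  then show ?case by (intro exI[of _ "1::real"] exI[of _ "1::nat"] conjI) auto
next
  case (Add p q)
  then obtain C c C' c' where p: "C \<ge> 0" "\<And>x. norm (eval p x) \<le> C * exp (real c * (\<bar>fst x\<bar> + \<bar>snd x\<bar>))"
    and q: "C' \<ge> 0" "\<And>x. norm (eval q x) \<le> C' * exp (real c' * (\<bar>fst x\<bar> + \<bar>snd x\<bar>))"
    by auto blast
  have "norm (eval (Add p q) x) \<le> (C + C') * exp (real (c + c') * (\<bar>fst x\<bar> + \<bar>snd x\<bar>))" for x
  proof -
    have e: "exp (real c * (\<bar>fst x\<bar> + \<bar>snd x\<bar>)) \<le> exp (real (c + c') * (\<bar>fst x\<bar> + \<bar>snd x\<bar>))"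
      "exp (real c' * (\<bar>fst x\<bar> + \<bar>snd x\<bar>)) \<le> exp (real (c + c') * (\<bar>fst x\<bar> + \<bar>snd x\<bar>))"
      by (auto simp del: of_nat_add intro!: mult_right_mono)
    have "norm (eval (Add p q) x) \<le> norm (eval p x) + norm (eval q x)"
      by (simp add: norm_triangle_ineq)
    also have "\<dots> \<le> C * exp (real (c + c') * (\<bar>fst x\<bar> + \<bar>snd x\<bar>)) + C' * exp (real (c + c') * (\<bar>fst x\<bar> + \<bar>snd x\<bar>))"
      using p q e by (intro add_mono order_trans[OF p(2)] order_trans[OF q(2)] mult_left_mono)
    finally show ?thesis by (simp add: algebra_simps)
  qed
  then show ?case using p(1) q(1) by (intro exI[of _ "C + C'"] exI[of _ "c + c'"] conjI) auto
next
  case (Mul p q)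
  then obtain C c C' c' where p: "C \<ge> 0" "\<And>x. norm (eval p x) \<le> C * exp (real c * (\<bar>fst x\<bar> + \<bar>snd x\<bar>))"
    and q: "C' \<ge> 0" "\<And>x. norm (eval q x) \<le> C' * exp (real c' * (\<bar>fst x\<bar> + \<bar>snd x\<bar>))"
    by auto blast
  have "norm (eval (Mul p q) x) \<le> (C * C') * exp (real (c + c') * (\<bar>fst x\<bar> + \<bar>snd x\<bar>))" for x
  proof -
    have "norm (eval (Mul p q) x) \<le> (C * exp (real c * (\<bar>fst x\<bar> + \<bar>snd x\<bar>))) * (C' * exp (real c' * (\<bar>fst x\<bar> + \<bar>snd x\<bar>)))"
      using p(1) by (auto simp: norm_mult intro!: mult_mono p(2) q(2))
    then show ?thesis by (simp add: algebra_simps exp_add)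
  qed
  then show ?case using p(1) q(1) by (intro exI[of _ "C * C'"] exI[of _ "c + c'"] conjI) auto
qed auto

text \<open>
Completing the square bounds the integrand by a normal density.
\<close>
lemma integrable_exp_abs_minus_square:
  fixes s c :: real
  assumes "s > 0"
  shows "integrable lborel (\<lambda>t. exp (c * \<bar>t\<bar> - s * t\<^sup>2))"
proof (rule Bochner_Integration.integrable_bound)
  define \<sigma> where "\<sigma> = 1 / sqrt s"
  have \<sigma>: "\<sigma> > 0" "\<sigma>\<^sup>2 = 1 / s" using assms by (auto simp: \<sigma>_def power_divide)
  let ?K = "exp (c\<^sup>2 / (2 * s)) * sqrt (2 * pi * \<sigma>\<^sup>2)"
  show "integrable lborel (\<lambda>t. ?K * normal_density 0 \<sigma> t)"
    using \<sigma> by (intro integrable_mult_right integrable_normal_density)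
  show "AE t in lborel. norm (exp (c * \<bar>t\<bar> - s * t\<^sup>2)) \<le> norm (?K * normal_density 0 \<sigma> t)"
  proof (rule AE_I2)
    fix t :: real
    (* the linear term is absorbed into half of the quadratic one *)
    have "0 \<le> (s * \<bar>t\<bar> - c)\<^sup>2 / (2 * s)" using assms by simp
    also have "\<dots> = s * t\<^sup>2 / 2 - c * \<bar>t\<bar> + c\<^sup>2 / (2 * s)"
      using assms by (simp add: power2_eq_square field_simps)
    finally have "exp (c * \<bar>t\<bar> - s * t\<^sup>2) \<le> exp (c\<^sup>2 / (2 * s) - s * t\<^sup>2 / 2)"
      by simp
    also have "\<dots> = ?K * normal_density 0 \<sigma> t"
    proof -
      have "t\<^sup>2 / (2 * \<sigma>\<^sup>2) = s * t\<^sup>2 / 2" using \<sigma> assms by simp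
      moreover have "exp (A - t2) = exp A * q * (1 / q * exp (- t2))" if "q > 0" for A t2 q :: real
        using that by (simp add: exp_diff exp_minus field_simps)
      ultimately show ?thesis
        using \<sigma>(1) unfolding normal_density_def diff_0_right minus_divide_left[symmetric] by auto
    qed
    finally show "norm (exp (c * \<bar>t\<bar> - s * t\<^sup>2)) \<le> norm (?K * normal_density 0 \<sigma> t)" by simp
  qed
qed simp

lemma integrable_plane_product:
  fixes f g :: "real \<Rightarrow> real"
  assumes f: "integrable lborel f" and g: "integrable lborel g"
  shows "integrable lborel (\<lambda>x. f (fst x) * g (snd x))"
proof -
  have [measurable]: "f \<in> borel_measurable borel" "g \<in> borel_measurable borel"
    using f g by auto
  have "integrable (lborel \<Otimes>\<^sub>M lborel) (\<lambda>x. f (fst x) * g (snd x))"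
  proof (rule lborel_pair.Fubini_integrable)
    show "integrable lborel (\<lambda>x. \<integral>y. norm (f (fst (x, y)) * g (snd (x, y))) \<partial>lborel)"
      using f by (simp add: abs_mult)
    show "AE x in lborel. integrable lborel (\<lambda>y. f (fst (x, y)) * g (snd (x, y)))"
      using g by simp
  qed simp
  then show ?thesis by (simp add: lborel_prod)
qed

lemma borel_measurable_cnj [measurable]:
  assumes "f \<in> borel_measurable M"
  shows "(\<lambda>x. cnj (f x)) \<in> borel_measurable M"
  by (rule measurable_compose[OF assms]) (intro borel_measurable_continuous_onI continuous_intros)

lemma L2_mult_integrable:
  assumes "f \<in> L2" "g \<in> L2"
  shows "integrable lborel (\<lambda>x. cnj (f x) * g x)"
proof (rule Bochner_Integration.integrable_bound)
  have [measurable]: "f \<in> borel_measurable borel" "g \<in> borel_measurable borel"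
    using assms by (auto simp: L2_def)
  show "integrable lborel (\<lambda>x. (norm (f x))\<^sup>2 + (norm (g x))\<^sup>2)"
    using assms by (simp add: L2_def)
  show "(\<lambda>x. cnj (f x) * g x) \<in> borel_measurable lborel" by simp
  show "AE x in lborel. norm (cnj (f x) * g x) \<le> norm ((norm (f x))\<^sup>2 + (norm (g x))\<^sup>2)"
  proof (rule AE_I2)
    fix x
    have "2 * (norm (f x) * norm (g x)) \<le> (norm (f x))\<^sup>2 + (norm (g x))\<^sup>2"
      using sum_squares_bound[of "norm (f x)" "norm (g x)"] by simp
    moreover have "0 \<le> norm (f x) * norm (g x)" by simp
    ultimately have "norm (f x) * norm (g x) \<le> (norm (f x))\<^sup>2 + (norm (g x))\<^sup>2" by linarith
    then show "norm (cnj (f x) * g x) \<le> norm ((norm (f x))\<^sup>2 + (norm (g x))\<^sup>2)"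
      by (simp add: norm_mult)
  qed
qed

lemma L2_lincomb:
  assumes "f \<in> L2" "g \<in> L2"
  shows "(\<lambda>x. a * f x + b * g x) \<in> L2"
proof -
  have [measurable]: "f \<in> borel_measurable borel" "g \<in> borel_measurable borel"
    using assms by (auto simp: L2_def)
  have "integrable lborel (\<lambda>x. (norm (a * f x + b * g x))\<^sup>2)"
  proof (rule Bochner_Integration.integrable_bound)
    show "integrable lborel (\<lambda>x. 2 * (norm a)\<^sup>2 * (norm (f x))\<^sup>2 + 2 * (norm b)\<^sup>2 * (norm (g x))\<^sup>2)"
      using assms by (simp add: L2_def)
    show "AE x in lborel. norm ((norm (a * f x + b * g x))\<^sup>2) \<le> norm (2 * (norm a)\<^sup>2 * (norm (f x))\<^sup>2 + 2 * (norm b)\<^sup>2 * (norm (g x))\<^sup>2)"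
    proof (rule AE_I2)
      fix x
      have "(norm (a * f x + b * g x))\<^sup>2 \<le> (norm a * norm (f x) + norm b * norm (g x))\<^sup>2"
        by (intro power_mono) (auto simp: norm_mult[symmetric] norm_triangle_ineq)
      also have "\<dots> \<le> 2 * (norm a * norm (f x))\<^sup>2 + 2 * (norm b * norm (g x))\<^sup>2"
        using zero_le_power2[of "norm a * norm (f x) - norm b * norm (g x)"]
        by (simp add: power2_sum power2_diff)
      finally show "norm ((norm (a * f x + b * g x))\<^sup>2) \<le> norm (2 * (norm a)\<^sup>2 * (norm (f x))\<^sup>2 + 2 * (norm b)\<^sup>2 * (norm (g x))\<^sup>2)"
        by (simp add: power_mult_distrib mult.assoc)
    qed
  qed simp
  then show ?thesis by (simp add: L2_def)
qed

section \<open>Polynomials times the ground state in the form domain\<close>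

text \<open>
The ground state is the Gaussian with exponent
\<open>- (a * x1\<^sup>2 + b * x2\<^sup>2) / 2 - \<i> * (b1 - b2) / 2 * x1 * x2\<close>. Its coefficients are found from the requirement
that the Hamiltonian maps it to a multiple of itself: the quadratic terms that are
produced by the two momenta cancel the potential exactly if \<open>a\<^sup>2 = \<omega>\<^sub>1\<^sup>2 + b1\<^sup>2\<close>, \<open>b\<^sup>2 = \<omega>\<^sub>2\<^sup>2 + b2\<^sup>2\<close>
and \<open>a * b2 = b * b1\<close> with \<open>b1 + b2 = B\<close>, so that \<open>B\<close> is divided in the ratio of the frequencies. The numbers
\<open>\<alpha>\<close> and \<open>\<beta>\<close> are the normal frequencies of the resulting pair of oscillators.
\<close>
locale landau_oscillator =
  fixes B \<omega>\<^sub>1 \<omega>\<^sub>2 \<mu> :: real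
  assumes B_pos: "B > 0" and \<omega>\<^sub>1_pos: "\<omega>\<^sub>1 > 0" and \<omega>\<^sub>2_pos: "\<omega>\<^sub>2 > 0"
begin

definition S :: real where "S = sqrt (B\<^sup>2 + (\<omega>\<^sub>1 + \<omega>\<^sub>2)\<^sup>2)"
definition T :: real where "T = sqrt (B\<^sup>2 + (\<omega>\<^sub>1 - \<omega>\<^sub>2)\<^sup>2)"
definition \<alpha> :: real where "\<alpha> = (S + T) / 2"
definition \<beta> :: real where "\<beta> = (S - T) / 2"
definition a :: real where "a = \<omega>\<^sub>1 * S / (\<omega>\<^sub>1 + \<omega>\<^sub>2)"
definition b :: real where "b = \<omega>\<^sub>2 * S / (\<omega>\<^sub>1 + \<omega>\<^sub>2)"
definition b1 :: real where "b1 = B * \<omega>\<^sub>1 / (\<omega>\<^sub>1 + \<omega>\<^sub>2)"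
definition b2 :: real where "b2 = B * \<omega>\<^sub>2 / (\<omega>\<^sub>1 + \<omega>\<^sub>2)"

lemma S_square: "S\<^sup>2 = B\<^sup>2 + (\<omega>\<^sub>1 + \<omega>\<^sub>2)\<^sup>2"
  and T_square: "T\<^sup>2 = B\<^sup>2 + (\<omega>\<^sub>1 - \<omega>\<^sub>2)\<^sup>2"
  by (simp_all add: S_def T_def)

lemma S_pos: "S > 0"
  using B_pos \<omega>\<^sub>1_pos \<omega>\<^sub>2_pos by (simp add: S_def add_pos_pos)

lemma T_ge_B: "T \<ge> B"
  using real_sqrt_le_mono[of "B\<^sup>2" "B\<^sup>2 + (\<omega>\<^sub>1 - \<omega>\<^sub>2)\<^sup>2"] B_pos by (simp add: T_def)

lemma T_less_S: "T < S"
  unfolding S_def T_def using \<omega>\<^sub>1_pos \<omega>\<^sub>2_pos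
  by (intro real_sqrt_less_mono) (simp add: power2_sum power2_diff)

lemma \<beta>_pos: "\<beta> > 0"
  using T_less_S by (simp add: \<beta>_def)

lemma \<alpha>_ge_B: "\<alpha> \<ge> B"
  using T_ge_B T_less_S by (simp add: \<alpha>_def)

lemma \<alpha>_plus_\<beta>: "\<alpha> + \<beta> = S"
  by (simp add: \<alpha>_def \<beta>_def field_simps)

lemma \<alpha>_minus_\<beta>: "\<alpha> - \<beta> > 0"
  using T_ge_B B_pos by (simp add: \<alpha>_def \<beta>_def field_simps)

lemma \<alpha>_times_\<beta>: "\<alpha> * \<beta> = \<omega>\<^sub>1 * \<omega>\<^sub>2"
proof -
  have "4 * (\<alpha> * \<beta>) = S\<^sup>2 - T\<^sup>2"
    by (simp add: \<alpha>_def \<beta>_def power2_eq_square field_simps)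
  then show ?thesis by (simp add: S_square T_square power2_sum power2_diff)
qed

lemma a_pos: "a > 0" and b_pos: "b > 0" and b1_pos: "b1 > 0"
  using B_pos \<omega>\<^sub>1_pos \<omega>\<^sub>2_pos S_pos by (simp_all add: a_def b_def b1_def)

lemma a_plus_b: "a + b = S"
proof -
  have "a + b = (\<omega>\<^sub>1 + \<omega>\<^sub>2) * S / (\<omega>\<^sub>1 + \<omega>\<^sub>2)"
    unfolding a_def b_def by (simp add: add_divide_distrib[symmetric] distrib_right)
  then show ?thesis using \<omega>\<^sub>1_pos \<omega>\<^sub>2_pos by simp
qed

lemma b1_plus_b2: "b1 + b2 = B"
proof -
  have "b1 + b2 = B * (\<omega>\<^sub>1 + \<omega>\<^sub>2) / (\<omega>\<^sub>1 + \<omega>\<^sub>2)"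
    unfolding b1_def b2_def by (simp add: add_divide_distrib[symmetric] distrib_left)
  then show ?thesis using \<omega>\<^sub>1_pos \<omega>\<^sub>2_pos by simp
qed

lemma a_square: "a\<^sup>2 = \<omega>\<^sub>1\<^sup>2 + b1\<^sup>2" and b_square: "b\<^sup>2 = \<omega>\<^sub>2\<^sup>2 + b2\<^sup>2"
proof -
  define w where "w = \<omega>\<^sub>1 + \<omega>\<^sub>2"
  have w: "w \<noteq> 0" using \<omega>\<^sub>1_pos \<omega>\<^sub>2_pos by (simp add: w_def)
  have "(z * S / w)\<^sup>2 = z\<^sup>2 + (B * z / w)\<^sup>2" for z
  proof -
    have "(z * S / w)\<^sup>2 = z\<^sup>2 * (B\<^sup>2 + w\<^sup>2) / w\<^sup>2"
      by (simp add: power_mult_distrib power_divide S_square w_def)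
    also have "\<dots> = z\<^sup>2 + (B * z / w)\<^sup>2"
      using w by (simp add: power_mult_distrib power_divide field_simps)
    finally show ?thesis .
  qed
  then show "a\<^sup>2 = \<omega>\<^sub>1\<^sup>2 + b1\<^sup>2" "b\<^sup>2 = \<omega>\<^sub>2\<^sup>2 + b2\<^sup>2"
    by (simp_all add: a_def b_def b1_def b2_def w_def)
qed

lemma a_b2: "a * b2 = b * b1"
  by (simp add: a_def b_def b1_def b2_def)

lemma ab_minus_b1b2: "a * b - b1 * b2 = \<omega>\<^sub>1 * \<omega>\<^sub>2"
proof -
  define w where "w = \<omega>\<^sub>1 + \<omega>\<^sub>2"
  have w: "w \<noteq> 0" using \<omega>\<^sub>1_pos \<omega>\<^sub>2_pos by (simp add: w_def)
  have "a * b - b1 * b2 = \<omega>\<^sub>1 * \<omega>\<^sub>2 * (S\<^sup>2 - B\<^sup>2) / w\<^sup>2"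
    unfolding a_def b_def b1_def b2_def w_def[symmetric]
    by (simp add: power2_eq_square algebra_simps diff_divide_distrib)
  also have "S\<^sup>2 - B\<^sup>2 = w\<^sup>2" by (simp add: S_square w_def)
  finally show ?thesis using w by simp
qed

text \<open>
The eigenvalue equation of the matrix of the drift, whose trace is \<open>a + b = \<alpha> + \<beta>\<close> and whose
determinant is \<open>a * b - b1 * b2 = \<alpha> * \<beta>\<close>.
\<close>
lemma characteristic_equation:
  assumes "s = \<alpha> \<or> s = \<beta>"
  shows "s * (s - a) = b1 * b2 + b * (s - a)"
proof -
  have "s\<^sup>2 - (\<alpha> + \<beta>) * s + \<alpha> * \<beta> = 0"
    using assms by (auto simp: power2_eq_square algebra_simps)
  then have "s\<^sup>2 - (a + b) * s + (a * b - b1 * b2) = 0"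
    by (simp add: \<alpha>_plus_\<beta> a_plus_b \<alpha>_times_\<beta> ab_minus_b1b2)
  then show ?thesis by (simp add: power2_eq_square algebra_simps)
qed

definition V :: "plane \<Rightarrow> real" where
  "V = (\<lambda>x. \<omega>\<^sub>1\<^sup>2 * (fst x)\<^sup>2 + \<omega>\<^sub>2\<^sup>2 * (snd x)\<^sup>2 - \<mu>)"

definition ground_exponent :: expr where
  "ground_exponent = Add (Add (Mul (Const (- of_real (a / 2))) (Mul X1 X1)) (Mul (Const (- of_real (b / 2))) (Mul X2 X2)))
     (Mul (Const (- \<i> * of_real ((b1 - b2) / 2))) (Mul X1 X2))"

definition ground :: expr where
  "ground = Exp ground_exponent"

lemma norm_ground: "norm (eval ground x) = exp (- (a / 2) * (fst x)\<^sup>2 - (b / 2) * (snd x)\<^sup>2)"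
  by (simp add: ground_def ground_exponent_def norm_exp_eq_Re power2_eq_square)

text \<open>
The momenta and the Hamiltonian (\<open>mom1\<close>, \<open>mom2\<close> and \<open>ham\<close>) as classical differential operators on
expressions, in contrast to those of the form domain, which involve weak derivatives.
\<close>
definition mom1 :: "expr \<Rightarrow> expr" where
  "mom1 v = Add (Mul (Const (- \<i>)) (D (1, 0) v)) (Mul (Const (of_real (B / 2))) (Mul X2 v))"

definition mom2 :: "expr \<Rightarrow> expr" where
  "mom2 v = Add (Mul (Const (- \<i>)) (D (0, 1) v)) (Mul (Const (- of_real (B / 2))) (Mul X1 v))"

definition pot :: expr where
  "pot = Add (Add (Mul (Const (of_real (\<omega>\<^sub>1\<^sup>2))) (Mul X1 X1)) (Mul (Const (of_real (\<omega>\<^sub>2\<^sup>2))) (Mul X2 X2))) (Const (- of_real \<mu>))"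

lemma eval_pot: "eval pot x = of_real (V x)"
  by (simp add: pot_def V_def power2_eq_square)

definition ham :: "expr \<Rightarrow> expr" where
  "ham v = Add (Add (mom1 (mom1 v)) (mom2 (mom2 v))) (Mul pot v)"

text \<open>
Polynomials times the ground state. The condition concerns the function and not the syntax, so that
it is stable under differentiation.
\<close>
definition hermite :: "expr \<Rightarrow> bool" where
  "hermite f \<longleftrightarrow> (\<exists>p. is_poly p \<and> (\<forall>x. eval f x = eval p x * eval ground x))"

lemma hermite_Mul_ground: "is_poly p \<Longrightarrow> hermite (Mul p ground)"
  by (auto simp: hermite_def)

lemma hermite_Add: "hermite f \<Longrightarrow> hermite g \<Longrightarrow> hermite (Add f g)"
proof -
  assume "hermite f" "hermite g"
  then obtain p q where "is_poly p" "is_poly q"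
    "\<And>x. eval f x = eval p x * eval ground x" "\<And>x. eval g x = eval q x * eval ground x"
    by (auto simp: hermite_def)
  then show ?thesis
    unfolding hermite_def by (intro exI[of _ "Add p q"]) (simp add: distrib_right)
qed

lemma hermite_Mul: "is_poly p \<Longrightarrow> hermite f \<Longrightarrow> hermite (Mul p f)"
proof -
  assume "is_poly p" "hermite f"
  then obtain q where "is_poly p" "is_poly q" "\<And>x. eval f x = eval q x * eval ground x"
    by (auto simp: hermite_def)
  then show ?thesis
    unfolding hermite_def by (intro exI[of _ "Mul p q"]) simp
qed

lemma is_poly_ground_exponent: "is_poly ground_exponent"
  by (simp add: ground_exponent_def)

lemma hermite_D: "hermite f \<Longrightarrow> hermite (D d f)"
proof -
  assume "hermite f"
  then obtain p where p: "is_poly p" "\<And>x. eval f x = eval (Mul p ground) x"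
    by (auto simp: hermite_def)
  have "eval (D d f) x = eval (Add (D d p) (Mul p (D d ground_exponent))) x * eval ground x" for x
    by (subst eval_D_cong[OF p(2)]) (simp add: ground_def algebra_simps)
  then show ?thesis unfolding hermite_def
    using p(1) is_poly_ground_exponent
    by (intro exI[of _ "Add (D d p) (Mul p (D d ground_exponent))"]) auto
qed

lemma hermite_mom1: "hermite f \<Longrightarrow> hermite (mom1 f)"
  and hermite_mom2: "hermite f \<Longrightarrow> hermite (mom2 f)"
  unfolding mom1_def mom2_def by (intro hermite_Add hermite_Mul hermite_D; simp)+

lemma integrable_gaussian_growth:
  "integrable lborel (\<lambda>x. (exp (c * (\<bar>fst x\<bar> + \<bar>snd x\<bar>)) * norm (eval ground x))\<^sup>2)"
proof -
  have "integrable lborel (\<lambda>x. exp (2 * c * \<bar>fst x\<bar> - a * (fst x)\<^sup>2) * exp (2 * c * \<bar>snd x\<bar> - b * (snd x)\<^sup>2))"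
    by (intro integrable_plane_product integrable_exp_abs_minus_square a_pos b_pos)
  moreover have "(exp (c * (\<bar>fst x\<bar> + \<bar>snd x\<bar>)) * norm (eval ground x))\<^sup>2
      = exp (2 * c * \<bar>fst x\<bar> - a * (fst x)\<^sup>2) * exp (2 * c * \<bar>snd x\<bar> - b * (snd x)\<^sup>2)" for x
    by (simp add: norm_ground exp_add[symmetric] power2_eq_square algebra_simps)
  ultimately show ?thesis by simp
qed

lemma gaussian_growth_L2: "(\<lambda>x. of_real (exp (c * (\<bar>fst x\<bar> + \<bar>snd x\<bar>))) * eval ground x) \<in> L2"
proof -
  have "(\<lambda>x::plane. complex_of_real (exp (c * (\<bar>fst x\<bar> + \<bar>snd x\<bar>)))) \<in> borel_measurable borel"
    by (intro borel_measurable_continuous_onI continuous_intros)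
  then show ?thesis
    unfolding L2_def using integrable_gaussian_growth[of c] by (simp add: norm_mult)
qed

lemma hermite_L2:
  assumes "hermite f"
  shows "eval f \<in> L2"
proof -
  obtain p where p: "is_poly p" "\<And>x. eval f x = eval p x * eval ground x"
    using assms by (auto simp: hermite_def)
  obtain C c where C: "C \<ge> 0" "\<And>x. norm (eval p x) \<le> C * exp (real c * (\<bar>fst x\<bar> + \<bar>snd x\<bar>))"
    using is_poly_growth[OF p(1)] by blast
  have "integrable lborel (\<lambda>x. (norm (eval f x))\<^sup>2)"
  proof (rule Bochner_Integration.integrable_bound)
    show "integrable lborel (\<lambda>x. C\<^sup>2 * (exp (real c * (\<bar>fst x\<bar> + \<bar>snd x\<bar>)) * norm (eval ground x))\<^sup>2)"
      by (intro integrable_mult_right integrable_gaussian_growth)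
    show "AE x in lborel. norm ((norm (eval f x))\<^sup>2)
        \<le> norm (C\<^sup>2 * (exp (real c * (\<bar>fst x\<bar> + \<bar>snd x\<bar>)) * norm (eval ground x))\<^sup>2)"
    proof (rule AE_I2)
      fix x
      have "norm (eval f x) \<le> C * exp (real c * (\<bar>fst x\<bar> + \<bar>snd x\<bar>)) * norm (eval ground x)"
        unfolding p(2) norm_mult by (intro mult_right_mono C) auto
      then have "(norm (eval f x))\<^sup>2 \<le> (C * exp (real c * (\<bar>fst x\<bar> + \<bar>snd x\<bar>)) * norm (eval ground x))\<^sup>2"
        by (intro power_mono) auto
      also have "\<dots> = C\<^sup>2 * (exp (real c * (\<bar>fst x\<bar> + \<bar>snd x\<bar>)) * norm (eval ground x))\<^sup>2"
        by (simp add: power_mult_distrib)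
      finally show "norm ((norm (eval f x))\<^sup>2)
        \<le> norm (C\<^sup>2 * (exp (real c * (\<bar>fst x\<bar> + \<bar>snd x\<bar>)) * norm (eval ground x))\<^sup>2)" by simp
    qed
  qed simp
  then show ?thesis by (simp add: L2_def)
qed

text \<open>
Symmetry of the magnetic momentum in direction \<open>e\<close>, with one argument merely in the form domain. The
polynomial \<open>r\<close> is the vector potential. The weak derivative of \<open>u\<close> is not itself known to be square
integrable; its product with a Gaussian is integrable because the momentum of \<open>u\<close> and \<open>u\<close> are.
\<close>
lemma L2_inner_hermite_momentum:
  assumes f: "hermite f" and u: "u \<in> L2" and e: "has_weak_derivative e u (weak_derivative e u)"
    and P: "(\<lambda>x. - \<i> * weak_derivative e u x + eval r x * u x) \<in> L2" and r: "is_poly r" "\<And>x. cnj (eval r x) = eval r x"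
  shows "L2_inner (eval f) (\<lambda>x. - \<i> * weak_derivative e u x + eval r x * u x)
    = L2_inner (eval (Add (Mul (Const (- \<i>)) (D e f)) (Mul r f))) u"
proof -
  let ?g = "weak_derivative e u"
  have int_u: "integrable lborel (\<lambda>x. cnj (eval h x) * u x)" if "hermite h" for h
    using hermite_L2[OF that] u by (rule L2_mult_integrable)
  have rf: "integrable lborel (\<lambda>x. cnj (eval f x) * (eval r x * u x))"
    using int_u[OF hermite_Mul[OF r(1) f]] by (simp add: r(2) mult_ac)
  (* the weak derivative is recovered from the momentum and the vector potential *)
  have gf: "integrable lborel (\<lambda>x. cnj (eval f x) * ?g x)"
  proof -
    have "integrable lborel (\<lambda>x. \<i> * (cnj (eval f x) * (- \<i> * ?g x + eval r x * u x) - cnj (eval f x) * (eval r x * u x)))"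
      using L2_mult_integrable[OF hermite_L2[OF f] P] rf
      by (intro integrable_mult_right Bochner_Integration.integrable_diff)
    then show ?thesis by (simp add: algebra_simps)
  qed
  have parts: "(\<integral>x. u x * eval (D e (conj_expr f)) x \<partial>lborel) = - (\<integral>x. ?g x * eval (conj_expr f) x \<partial>lborel)"
  proof (rule weak_derivative_parts[OF e])
    show "integrable lborel (\<lambda>x. u x * eval (conj_expr f) x)"
      using int_u[OF f] by (simp add: eval_conj_expr mult.commute)
    show "integrable lborel (\<lambda>x. u x * eval (D e (conj_expr f)) x)"
      using int_u[OF hermite_D[OF f, of e]] by (simp add: D_conj_expr eval_conj_expr mult.commute)
    show "integrable lborel (\<lambda>x. ?g x * eval (conj_expr f) x)"
      using gf by (simp add: eval_conj_expr mult.commute)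
  qed
  have "L2_inner (eval f) (\<lambda>x. - \<i> * ?g x + eval r x * u x)
      = (\<integral>x. - \<i> * (cnj (eval f x) * ?g x) + cnj (eval f x) * (eval r x * u x) \<partial>lborel)"
    unfolding L2_inner_def by (intro Bochner_Integration.integral_cong) (auto simp: algebra_simps)
  also have "\<dots> = - \<i> * (\<integral>x. cnj (eval f x) * ?g x \<partial>lborel) + (\<integral>x. cnj (eval f x) * (eval r x * u x) \<partial>lborel)"
    using gf rf by (subst Bochner_Integration.integral_add) (auto simp: integral_mult_right_zero)
  also have "(\<integral>x. cnj (eval f x) * ?g x \<partial>lborel) = - (\<integral>x. cnj (eval (D e f) x) * u x \<partial>lborel)"
    using parts by (simp add: D_conj_expr eval_conj_expr mult.commute)
  also have "- \<i> * - (\<integral>x. cnj (eval (D e f) x) * u x \<partial>lborel) + (\<integral>x. cnj (eval f x) * (eval r x * u x) \<partial>lborel)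
     = (\<integral>x. \<i> * (cnj (eval (D e f) x) * u x) + cnj (eval f x) * (eval r x * u x) \<partial>lborel)"
    using int_u[OF hermite_D[OF f, of e]] rf
    by (subst Bochner_Integration.integral_add) (auto simp: integral_mult_right_zero)
  also have "\<dots> = L2_inner (eval (Add (Mul (Const (- \<i>)) (D e f)) (Mul r f))) u"
    unfolding L2_inner_def by (intro Bochner_Integration.integral_cong) (auto simp: algebra_simps r(2))
  finally show ?thesis .
qed

lemma has_weak_derivative_weak_derivative:
  assumes "\<exists>g. has_weak_derivative e u g"
  shows "has_weak_derivative e u (weak_derivative e u)"
  unfolding weak_derivative_def using assms by (rule someI_ex)

lemma L2_inner_hermite_momentum1:
  assumes f: "hermite f" and u: "u \<in> landau_form_domain B"
  shows "L2_inner (eval f) (momentum1 B u) = L2_inner (eval (mom1 f)) u"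
proof -
  let ?r = "Mul (Const (of_real (B / 2))) X2"
  have m: "momentum1 B u = (\<lambda>x. - \<i> * weak_derivative (1, 0) u x + eval ?r x * u x)"
    by (simp add: momentum1_def)
  have "L2_inner (eval f) (momentum1 B u) = L2_inner (eval (Add (Mul (Const (- \<i>)) (D (1, 0) f)) (Mul ?r f))) u"
    unfolding m using u m
    by (intro L2_inner_hermite_momentum f has_weak_derivative_weak_derivative)
       (auto simp: landau_form_domain_def)
  then show ?thesis by (simp add: mom1_def L2_inner_def mult.assoc)
qed

lemma L2_inner_hermite_momentum2:
  assumes f: "hermite f" and u: "u \<in> landau_form_domain B"
  shows "L2_inner (eval f) (momentum2 B u) = L2_inner (eval (mom2 f)) u"
proof -
  let ?r = "Mul (Const (- of_real (B / 2))) X1"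
  have m: "momentum2 B u = (\<lambda>x. - \<i> * weak_derivative (0, 1) u x + eval ?r x * u x)"
    by (simp add: momentum2_def)
  have "L2_inner (eval f) (momentum2 B u) = L2_inner (eval (Add (Mul (Const (- \<i>)) (D (0, 1) f)) (Mul ?r f))) u"
    unfolding m using u m
    by (intro L2_inner_hermite_momentum f has_weak_derivative_weak_derivative)
       (auto simp: landau_form_domain_def)
  then show ?thesis by (simp add: mom2_def L2_inner_def mult.assoc)
qed

lemma weak_derivative_eval_AE:
  assumes "e \<in> {(1, 0), (0, 1)}"
  shows "AE x in lborel. weak_derivative e (eval f) x = eval (D e f) x"
    and "weak_derivative e (eval f) \<in> borel_measurable borel"
proof -
  have w: "has_weak_derivative e (eval f) (weak_derivative e (eval f))"
    using eval_has_weak_derivative[OF assms] by (intro has_weak_derivative_weak_derivative exI)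
  show "AE x in lborel. weak_derivative e (eval f) x = eval (D e f) x"
    using w eval_has_weak_derivative[OF assms] by (rule weak_derivative_unique)
  show "weak_derivative e (eval f) \<in> borel_measurable borel"
    using w by (auto simp: has_weak_derivative_def intro: locally_integrable_measurable)
qed

text \<open>
Here the uniqueness of weak derivatives enters: whichever weak derivative the definition of the
momentum picks, it agrees almost everywhere with the classical one.
\<close>
lemma momentum_eval_AE:
  "AE x in lborel. momentum1 B (eval f) x = eval (mom1 f) x"
  "AE x in lborel. momentum2 B (eval f) x = eval (mom2 f) x"
proof -
  have "AE x in lborel. weak_derivative (1, 0) (eval f) x = eval (D (1, 0) f) x"
    by (rule weak_derivative_eval_AE) simp
  then show "AE x in lborel. momentum1 B (eval f) x = eval (mom1 f) x"
    by eventually_elim (simp add: momentum1_def mom1_def)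
  have "AE x in lborel. weak_derivative (0, 1) (eval f) x = eval (D (0, 1) f) x"
    by (rule weak_derivative_eval_AE) simp
  then show "AE x in lborel. momentum2 B (eval f) x = eval (mom2 f) x"
    by eventually_elim (simp add: momentum2_def mom2_def)
qed

lemma momentum_eval_measurable:
  "momentum1 B (eval f) \<in> borel_measurable borel" "momentum2 B (eval f) \<in> borel_measurable borel"
proof -
  have w: "weak_derivative (1, 0) (eval f) \<in> borel_measurable borel"
    "weak_derivative (0, 1) (eval f) \<in> borel_measurable borel"
    by (rule weak_derivative_eval_AE(2); simp)+
  have c: "(\<lambda>x::plane. complex_of_real (B * snd x / 2)) \<in> borel_measurable borel"
    "(\<lambda>x::plane. complex_of_real (B * fst x / 2)) \<in> borel_measurable borel"
    by (intro borel_measurable_continuous_onI continuous_intros; simp)+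
  show "momentum1 B (eval f) \<in> borel_measurable borel" "momentum2 B (eval f) \<in> borel_measurable borel"
    unfolding momentum1_def momentum2_def
    by (intro borel_measurable_add borel_measurable_diff borel_measurable_times borel_measurable_const
        borel_measurable_eval w c)+
qed

lemma L2_cong_AE:
  assumes "f \<in> L2" "AE x in lborel. g x = f x" "g \<in> borel_measurable borel"
  shows "g \<in> L2"
proof -
  have "integrable lborel (\<lambda>x. (cmod (g x))\<^sup>2) \<longleftrightarrow> integrable lborel (\<lambda>x. (cmod (f x))\<^sup>2)"
    using assms by (intro integrable_cong_AE) (auto simp: L2_def)
  then show ?thesis using assms by (simp add: L2_def)
qed

lemma hermite_form_domain:
  assumes "hermite f"
  shows "eval f \<in> landau_form_domain B" "eval f \<in> potential_form_domain V"
proof -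
  have "momentum1 B (eval f) \<in> L2" "momentum2 B (eval f) \<in> L2"
    using assms
    by (auto intro!: L2_cong_AE[OF hermite_L2 momentum_eval_AE(1)] L2_cong_AE[OF hermite_L2 momentum_eval_AE(2)]
        hermite_mom1 hermite_mom2 momentum_eval_measurable)
  then show "eval f \<in> landau_form_domain B"
    using hermite_L2[OF assms] eval_has_weak_derivative by (auto simp: landau_form_domain_def)
  have "integrable lborel (\<lambda>x. cnj (eval f x) * eval (Mul pot f) x)"
    using assms by (intro L2_mult_integrable hermite_L2 hermite_Mul) (auto simp: pot_def)
  then have "integrable lborel (\<lambda>x. norm (cnj (eval f x) * eval (Mul pot f) x))"
    by (rule integrable_norm)
  then show "eval f \<in> potential_form_domain V"
    using hermite_L2[OF assms]
    by (simp add: potential_form_domain_def eval_pot norm_mult power2_eq_square mult_ac)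
qed

text \<open>
The weak eigenvalue equation of \<open>u\<close> is tested with the function \<open>f\<close>, and both momenta are moved from
\<open>u\<close> to \<open>f\<close>.
\<close>
lemma eigenfunction_L2_inner:
  assumes u: "u \<in> eigenspace (landau_plus_potential B V) l" and f: "hermite f"
  shows "L2_inner (eval (ham f)) u = of_real l * L2_inner (eval f) u"
proof -
  have dom: "u \<in> landau_form_domain B" "u \<in> L2"
    and eq: "landau_form B (eval f) u + potential_form V (eval f) u = L2_inner (eval f) (\<lambda>x. of_real l * u x)"
    using u hermite_form_domain[OF f]
    by (auto simp: eigenspace_def landau_plus_potential_def form_operator_def landau_form_domain_def)
  have mom_L2: "momentum1 B u \<in> L2" "momentum2 B u \<in> L2"
    using dom by (auto simp: landau_form_domain_def)
  have [measurable]: "momentum1 B u \<in> borel_measurable borel" "momentum2 B u \<in> borel_measurable borel"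
    using mom_L2 by (auto simp: L2_def)
  note [measurable] = momentum_eval_measurable
  have int: "integrable lborel (\<lambda>x. cnj (eval h x) * u x)" if "hermite h" for h
    using hermite_L2[OF that] dom(2) by (rule L2_mult_integrable)
  have "L2_inner (momentum1 B (eval f)) (momentum1 B u) = L2_inner (eval (mom1 f)) (momentum1 B u)"
    unfolding L2_inner_def using momentum_eval_AE(1)[of f]
    by (intro integral_cong_AE) (auto elim!: eventually_mono)
  also have "\<dots> = L2_inner (eval (mom1 (mom1 f))) u"
    by (intro L2_inner_hermite_momentum1 hermite_mom1 f dom)
  finally have 1: "L2_inner (momentum1 B (eval f)) (momentum1 B u) = L2_inner (eval (mom1 (mom1 f))) u" .
  have "L2_inner (momentum2 B (eval f)) (momentum2 B u) = L2_inner (eval (mom2 f)) (momentum2 B u)"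
    unfolding L2_inner_def using momentum_eval_AE(2)[of f]
    by (intro integral_cong_AE) (auto elim!: eventually_mono)
  also have "\<dots> = L2_inner (eval (mom2 (mom2 f))) u"
    by (intro L2_inner_hermite_momentum2 hermite_mom2 f dom)
  finally have 2: "L2_inner (momentum2 B (eval f)) (momentum2 B u) = L2_inner (eval (mom2 (mom2 f))) u" .
  have 3: "potential_form V (eval f) u = L2_inner (eval (Mul pot f)) u"
    unfolding potential_form_def L2_inner_def by (simp add: eval_pot)
  have pf: "hermite (Mul pot f)" using f by (intro hermite_Mul) (auto simp: pot_def)
  have "L2_inner (eval (ham f)) u
     = (\<integral>x. (cnj (eval (mom1 (mom1 f)) x) * u x + cnj (eval (mom2 (mom2 f)) x) * u x) + cnj (eval (Mul pot f) x) * u x \<partial>lborel)"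
    unfolding L2_inner_def ham_def by (intro Bochner_Integration.integral_cong) (auto simp: distrib_right)
  also have "\<dots> = L2_inner (eval (mom1 (mom1 f))) u + L2_inner (eval (mom2 (mom2 f))) u + L2_inner (eval (Mul pot f)) u"
    unfolding L2_inner_def
    using int[OF hermite_mom1[OF hermite_mom1[OF f]]] int[OF hermite_mom2[OF hermite_mom2[OF f]]] int[OF pf]
    by (simp only: Bochner_Integration.integral_add Bochner_Integration.integrable_add)
  also have "\<dots> = L2_inner (eval f) (\<lambda>x. of_real l * u x)"
    using eq unfolding landau_form_def 1 2 3 .
  also have "\<dots> = (\<integral>x. of_real l * (cnj (eval f x) * u x) \<partial>lborel)"
    unfolding L2_inner_def by (simp add: mult_ac)
  also have "\<dots> = of_real l * L2_inner (eval f) u"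
    unfolding L2_inner_def by (rule integral_mult_right_zero)
  finally show ?thesis .
qed

section \<open>Triangular action of the Hamiltonian on the excited states\<close>

text \<open>
The two linear forms are the eigenvectors of the drift, for the eigenvalues \<open>2 * \<alpha>\<close> and \<open>2 * \<beta>\<close>
(lemma \<open>drift_linear_forms\<close>). They are linearly independent since \<open>b1 > 0\<close> and \<open>\<alpha> > \<beta>\<close>, which is
where the magnetic field has to be non-zero.
\<close>
definition X :: expr where
  "X = Add (Mul (Const (\<i> * of_real b1)) X1) (Mul (Const (of_real (\<alpha> - a))) X2)"

definition Y :: expr where
  "Y = Add (Mul (Const (\<i> * of_real b1)) X1) (Mul (Const (of_real (\<beta> - a))) X2)"

definition excited :: "nat \<Rightarrow> nat \<Rightarrow> expr" where
  "excited j k = Mul (Mul (Pow X j) (Pow Y k)) ground"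

definition energy :: "nat \<Rightarrow> nat \<Rightarrow> real" where
  "energy j k = (2 * real j + 1) * \<alpha> + (2 * real k + 1) * \<beta> - \<mu>"

text \<open>
The Hamiltonian conjugated with the ground state: minus the Laplacian, plus a drift along a linear
vector field, plus the ground state energy.
\<close>
lemma ham_Mul_ground:
  defines "d1 \<equiv> D (1, 0)" and "d2 \<equiv> D (0, 1)"
  shows "eval (ham (Mul p ground)) x =
    (- (eval (d1 (d1 p)) x + eval (d2 (d2 p)) x)
     + (2 * of_real a * of_real (fst x) - 2 * \<i> * of_real b2 * of_real (snd x)) * eval (d1 p) x
     + (2 * of_real b * of_real (snd x) + 2 * \<i> * of_real b1 * of_real (fst x)) * eval (d2 p) x
     + of_real (\<alpha> + \<beta> - \<mu>) * eval p x) * eval ground x"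
proof -
  define s t where "s = complex_of_real (fst x)" and "t = complex_of_real (snd x)"
  define A A' R R' where "A = complex_of_real a" and "A' = complex_of_real b"
    and "R = complex_of_real b1" and "R' = complex_of_real b2"
  define c M where "c = (R - R') / 2" and "M = (R + R') / 2"
  have B: "R + R' = complex_of_real B"
    unfolding R_def R'_def of_real_add[symmetric] b1_plus_b2 ..
  have half: "complex_of_real (a / 2) = A / 2" "complex_of_real (b / 2) = A' / 2"
    "complex_of_real ((b1 - b2) / 2) = c"
    by (simp_all add: A_def A'_def R_def R'_def c_def)
  have half': "complex_of_real (B / 2) = M"
    by (simp add: B M_def)
  have sq: "complex_of_real (\<omega>\<^sub>1\<^sup>2) = A * A - R * R" "complex_of_real (\<omega>\<^sub>2\<^sup>2) = A' * A' - R' * R'"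
    using a_square b_square unfolding A_def A'_def R_def R'_def
    by (simp_all add: power2_eq_square flip: of_real_mult of_real_diff)
  have cross: "A * R' = A' * R"
    using a_b2 by (simp add: A_def A'_def R_def R'_def flip: of_real_mult)
  have sum: "complex_of_real (\<alpha> + \<beta> - \<mu>) = A + A' - of_real \<mu>"
    by (simp add: \<alpha>_plus_\<beta> a_plus_b[symmetric] A_def A'_def)
  define P P1 P2 P11 P22 E where "P = eval p x" and "P1 = eval (d1 p) x" and "P2 = eval (d2 p) x"
    and "P11 = eval (d1 (d1 p)) x" and "P22 = eval (d2 (d2 p)) x" and "E = eval ground x"
  define Q1 Q2 where "Q1 = - A * s - \<i> * c * t" and "Q2 = - A' * t - \<i> * c * s"
  have e1: "eval (D (1, 0) ground) x = Q1 * E" "eval (D (0, 1) ground) x = Q2 * E"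
    "eval (D (1, 0) (D (1, 0) ground)) x = (Q1 * Q1 - A) * E"
    "eval (D (0, 1) (D (0, 1) ground)) x = (Q2 * Q2 - A') * E"
    unfolding ground_def ground_exponent_def Q1_def Q2_def E_def half s_def t_def
    by (simp_all add: field_simps)
  have m1: "eval (mom1 (mom1 (Mul p ground))) x =
     - (P11 + 2 * P1 * Q1 + P * (Q1 * Q1 - A)) * E
     - 2 * \<i> * (M * t) * (P1 + P * Q1) * E + (M * t)^2 * P * E"
    unfolding mom1_def half' P_def P1_def P11_def d1_def t_def
    by (simp add: e1 E_def[symmetric] power2_eq_square algebra_simps)
  have m2: "eval (mom2 (mom2 (Mul p ground))) x =
     - (P22 + 2 * P2 * Q2 + P * (Q2 * Q2 - A')) * E
     + 2 * \<i> * (M * s) * (P2 + P * Q2) * E + (M * s)^2 * P * E"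
    unfolding mom2_def half' P_def P2_def P22_def d2_def s_def
    by (simp add: e1 E_def[symmetric] power2_eq_square algebra_simps)
  have pt: "eval pot x = (A * A - R * R) * (s * s) + (A' * A' - R' * R') * (t * t) - of_real \<mu>"
    unfolding pot_def sq s_def t_def by simp
  (* the part of the product that multiplies p: all quadratic terms cancel *)
  have zero: "- (Q1 * Q1) - (Q2 * Q2) - 2 * \<i> * (M * t) * Q1 + 2 * \<i> * (M * s) * Q2
      + (M * t)^2 + (M * s)^2
      + (A * A - R * R) * (s * s) + (A' * A' - R' * R') * (t * t) = 0"
  proof -
    have "- (Q1 * Q1) - 2 * \<i> * (M * t) * Q1 + (M * t)^2 = - (Q1 + \<i> * (M * t))\<^sup>2"
      by (simp add: power2_eq_square algebra_simps)
    also have "Q1 + \<i> * (M * t) = - A * s + \<i> * (R' * t)"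
      by (simp add: Q1_def c_def M_def field_simps)
    finally have 1: "- (Q1 * Q1) - 2 * \<i> * (M * t) * Q1 + (M * t)^2 = - (- A * s + \<i> * (R' * t))\<^sup>2" .
    have "- (Q2 * Q2) + 2 * \<i> * (M * s) * Q2 + (M * s)^2 = - (Q2 - \<i> * (M * s))\<^sup>2"
      by (simp add: power2_eq_square algebra_simps)
    also have "Q2 - \<i> * (M * s) = - A' * t - \<i> * (R * s)"
      by (simp add: Q2_def c_def M_def field_simps)
    finally have 2: "- (Q2 * Q2) + 2 * \<i> * (M * s) * Q2 + (M * s)^2 = - (- A' * t - \<i> * (R * s))\<^sup>2" .
    have "- (- A * s + \<i> * (R' * t))\<^sup>2 + - (- A' * t - \<i> * (R * s))\<^sup>2
        + (A * A - R * R) * (s * s) + (A' * A' - R' * R') * (t * t) = 2 * \<i> * (s * t) * (A * R' - A' * R)"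
      by (simp add: power2_eq_square algebra_simps)
    also have "\<dots> = 0" by (simp add: cross)
    finally have 3: "- (- A * s + \<i> * (R' * t))\<^sup>2 + - (- A' * t - \<i> * (R * s))\<^sup>2
        + (A * A - R * R) * (s * s) + (A' * A' - R' * R') * (t * t) = 0" .
    show ?thesis using 3 unfolding 1[symmetric] 2[symmetric] by (simp add: algebra_simps)
  qed
  have drift: "- 2 * Q1 - 2 * \<i> * (M * t) = 2 * A * s - 2 * \<i> * R' * t"
    "- 2 * Q2 + 2 * \<i> * (M * s) = 2 * A' * t + 2 * \<i> * R * s"
    by (simp_all add: Q1_def Q2_def c_def M_def field_simps)
  have "eval (ham (Mul p ground)) x = (- (P11 + P22)
      + (- 2 * Q1 - 2 * \<i> * (M * t)) * P1
      + (- 2 * Q2 + 2 * \<i> * (M * s)) * P2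
      + (A + A' - of_real \<mu>) * P
      + (- (Q1 * Q1) - (Q2 * Q2) - 2 * \<i> * (M * t) * Q1 + 2 * \<i> * (M * s) * Q2
      + (M * t)^2 + (M * s)^2
      + (A * A - R * R) * (s * s) + (A' * A' - R' * R') * (t * t)) * P) * E"
    unfolding ham_def eval.simps(4) m1 m2
    by (simp only: eval.simps(5) pt P_def[symmetric] E_def[symmetric])
       (simp only: ring_distribs mult_ac add_ac minus_mult_left[symmetric] mult_minus_left mult_minus_right diff_conv_add_uminus minus_add_distrib minus_minus)
  then show ?thesis
    unfolding zero drift sum
    by (simp add: P_def P1_def P2_def P11_def P22_def E_def A_def A'_def R_def R'_def s_def t_def)
qed

lemma drift_linear_forms:
  fixes x :: plane
  defines "d1 \<equiv> 2 * of_real a * of_real (fst x) - 2 * \<i> * of_real b2 * of_real (snd x)"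
    and "d2 \<equiv> 2 * of_real b * of_real (snd x) + 2 * \<i> * of_real b1 * of_real (fst x)"
  shows "d1 * eval (D (1, 0) X) x + d2 * eval (D (0, 1) X) x = 2 * of_real \<alpha> * eval X x"
    and "d1 * eval (D (1, 0) Y) x + d2 * eval (D (0, 1) Y) x = 2 * of_real \<beta> * eval Y x"
proof -
  have gen: "d1 * (\<i> * of_real b1) + d2 * of_real (s - a)
      = 2 * of_real s * (\<i> * of_real b1 * of_real (fst x) + of_real (s - a) * of_real (snd x))"
    if "s = \<alpha> \<or> s = \<beta>" for s
  proof -
    have "d1 * (\<i> * of_real b1) + d2 * of_real (s - a)
      = 2 * \<i> * of_real (s * b1) * of_real (fst x) + 2 * of_real (b1 * b2 + b * (s - a)) * of_real (snd x)"
      unfolding d1_def d2_def by (simp add: algebra_simps)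
    also have "\<dots> = 2 * of_real s * (\<i> * of_real b1 * of_real (fst x) + of_real (s - a) * of_real (snd x))"
      unfolding characteristic_equation[OF that, symmetric] by (simp add: algebra_simps)
    finally show ?thesis .
  qed
  show "d1 * eval (D (1, 0) X) x + d2 * eval (D (0, 1) X) x = 2 * of_real \<alpha> * eval X x"
    using gen[of \<alpha>] by (simp add: X_def)
  show "d1 * eval (D (1, 0) Y) x + d2 * eval (D (0, 1) Y) x = 2 * of_real \<beta> * eval Y x"
    using gen[of \<beta>] by (simp add: Y_def)
qed

lemma eval_D_XY:
  "eval (D (1, 0) X) x = \<i> * of_real b1" "eval (D (0, 1) X) x = of_real (\<alpha> - a)"
  "eval (D (1, 0) Y) x = \<i> * of_real b1" "eval (D (0, 1) Y) x = of_real (\<beta> - a)"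
  "eval (D d (D d X)) x = 0" "eval (D d (D d Y)) x = 0"
  by (simp_all add: X_def Y_def)

lemma eval_D_D_Mul:
  "eval (D d (D d (Mul e f))) x = eval (D d (D d e)) x * eval f x + 2 * eval (D d e) x * eval (D d f) x + eval e x * eval (D d (D d f)) x"
  by simp

lemma of_nat_mult_power_pred: "of_nat n * z ^ (n - 1) * z = of_nat n * (z :: complex) ^ n"
  by (cases n) auto

text \<open>
The drift acts diagonally on \<open>X^j * Y^k\<close>, while the Laplacian lowers the degree by two, so the matrix
of the Hamiltonian is triangular. Where the truncated subtraction of exponents differs from the true one,
the factors \<open>j * (j - 1)\<close>, \<open>j * k\<close> and \<open>k * (k - 1)\<close> vanish.
\<close>
lemma ham_excited:
  "\<exists>c1 c2 c3. \<forall>j k x. eval (ham (excited j k)) x = of_real (energy j k) * eval (excited j k) x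
     + c1 * of_nat (j * (j - 1)) * eval (excited (j - 2) k) x
     + c2 * of_nat (j * k) * eval (excited (j - 1) (k - 1)) x
     + c3 * of_nat (k * (k - 1)) * eval (excited j (k - 2)) x"
proof -
  define u1 u2 v2 where "u1 = \<i> * complex_of_real b1" and "u2 = complex_of_real (\<alpha> - a)" and "v2 = complex_of_real (\<beta> - a)"
  note DXY = eval_D_XY(1-4)[folded u1_def u2_def v2_def]
  show ?thesis
  proof (intro exI allI)
    fix j k :: nat and x :: plane
    define d1 d2 where "d1 = 2 * complex_of_real a * of_real (fst x) - 2 * \<i> * of_real b2 * of_real (snd x)"
      and "d2 = 2 * complex_of_real b * of_real (snd x) + 2 * \<i> * of_real b1 * of_real (fst x)"
    define p q E where "p = eval X x" and "q = eval Y x" and "E = eval ground x"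
    define J K where "J = complex_of_nat j" and "K = complex_of_nat k"
    note drift = drift_linear_forms[of x, folded d1_def d2_def p_def q_def, unfolded DXY]
    let ?m = "Mul (Pow X j) (Pow Y k)"
    have D1: "eval (D (1, 0) ?m) x = J * p ^ (j - 1) * u1 * q ^ k + p ^ j * (K * q ^ (k - 1) * u1)"
      and D2: "eval (D (0, 1) ?m) x = J * p ^ (j - 1) * u2 * q ^ k + p ^ j * (K * q ^ (k - 1) * v2)"
      by (simp_all add: eval_D_Pow DXY p_def q_def J_def K_def)
    have DD1: "eval (D (1, 0) (D (1, 0) ?m)) x = J * of_nat (j - 1) * p ^ (j - 2) * u1\<^sup>2 * q ^ k
        + 2 * (J * p ^ (j - 1) * u1) * (K * q ^ (k - 1) * u1) + p ^ j * (K * of_nat (k - 1) * q ^ (k - 2) * u1\<^sup>2)"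
      and DD2: "eval (D (0, 1) (D (0, 1) ?m)) x = J * of_nat (j - 1) * p ^ (j - 2) * u2\<^sup>2 * q ^ k
        + 2 * (J * p ^ (j - 1) * u2) * (K * q ^ (k - 1) * v2) + p ^ j * (K * of_nat (k - 1) * q ^ (k - 2) * v2\<^sup>2)"
      unfolding eval_D_D_Mul
      by (simp_all only: eval_D_D_Pow[OF eval_D_XY(5)] eval_D_D_Pow[OF eval_D_XY(6)] eval_D_Pow eval_Pow DXY
          p_def[symmetric] q_def[symmetric] J_def[symmetric] K_def[symmetric])
    have dr: "d1 * eval (D (1, 0) ?m) x + d2 * eval (D (0, 1) ?m) x = (2 * of_real \<alpha> * J + 2 * of_real \<beta> * K) * (p ^ j * q ^ k)"
    proof -
      have "d1 * eval (D (1, 0) ?m) x + d2 * eval (D (0, 1) ?m) x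
         = J * p ^ (j - 1) * (d1 * u1 + d2 * u2) * q ^ k + p ^ j * (K * q ^ (k - 1) * (d1 * u1 + d2 * v2))"
        unfolding D1 D2 by (simp add: algebra_simps)
      also have "\<dots> = 2 * of_real \<alpha> * (J * p ^ (j - 1) * p) * q ^ k + p ^ j * (2 * of_real \<beta> * (K * q ^ (k - 1) * q))"
        unfolding drift by (simp add: mult_ac)
      also have "\<dots> = 2 * of_real \<alpha> * (J * p ^ j) * q ^ k + p ^ j * (2 * of_real \<beta> * (K * q ^ k))"
        unfolding J_def K_def of_nat_mult_power_pred ..
      finally show ?thesis by (simp add: algebra_simps)
    qed
    have l: "complex_of_real (energy j k) = 2 * of_real \<alpha> * J + 2 * of_real \<beta> * K + of_real (\<alpha> + \<beta> - \<mu>)"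
      by (simp add: energy_def J_def K_def algebra_simps)
    have "eval (ham (excited j k)) x = (- (eval (D (1, 0) (D (1, 0) ?m)) x + eval (D (0, 1) (D (0, 1) ?m)) x)
        + (d1 * eval (D (1, 0) ?m) x + d2 * eval (D (0, 1) ?m) x) + of_real (\<alpha> + \<beta> - \<mu>) * eval ?m x) * E"
      unfolding excited_def ham_Mul_ground d1_def d2_def E_def by (simp only: add.assoc)
    also have "\<dots> = of_real (energy j k) * (p ^ j * q ^ k * E)
      + - (u1\<^sup>2 + u2\<^sup>2) * (J * of_nat (j - 1)) * (p ^ (j - 2) * q ^ k * E)
      + - (2 * (u1 * u1 + u2 * v2)) * (J * K) * (p ^ (j - 1) * q ^ (k - 1) * E)
      + - (u1\<^sup>2 + v2\<^sup>2) * (K * of_nat (k - 1)) * (p ^ j * q ^ (k - 2) * E)"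
      unfolding dr DD1 DD2 l eval.simps eval_Pow p_def[symmetric] q_def[symmetric]
      by (simp add: algebra_simps)
    finally show "eval (ham (excited j k)) x = of_real (energy j k) * eval (excited j k) x
     + - (u1\<^sup>2 + u2\<^sup>2) * of_nat (j * (j - 1)) * eval (excited (j - 2) k) x
     + - (2 * (u1 * u1 + u2 * v2)) * of_nat (j * k) * eval (excited (j - 1) (k - 1)) x
     + - (u1\<^sup>2 + v2\<^sup>2) * of_nat (k * (k - 1)) * eval (excited j (k - 2)) x"
      by (simp only: excited_def eval.simps eval_Pow p_def q_def E_def J_def K_def of_nat_mult)
  qed
qed

section \<open>Multiplicities and the trace\<close>

lemma hermite_excited: "hermite (excited j k)"
  unfolding excited_def by (intro hermite_Mul_ground) (simp add: X_def Y_def)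

lemma coefficient_recursion:
  "\<exists>c1 c2 c3. \<forall>u l j k. u \<in> eigenspace (landau_plus_potential B V) l \<longrightarrow>
     of_real (l - energy j k) * L2_inner (eval (excited j k)) u =
       c1 * of_nat (j * (j - 1)) * L2_inner (eval (excited (j - 2) k)) u
     + c2 * of_nat (j * k) * L2_inner (eval (excited (j - 1) (k - 1))) u
     + c3 * of_nat (k * (k - 1)) * L2_inner (eval (excited j (k - 2))) u"
proof -
  obtain c1 c2 c3 where c: "\<And>j k x. eval (ham (excited j k)) x = of_real (energy j k) * eval (excited j k) x
     + c1 * of_nat (j * (j - 1)) * eval (excited (j - 2) k) x
     + c2 * of_nat (j * k) * eval (excited (j - 1) (k - 1)) x
     + c3 * of_nat (k * (k - 1)) * eval (excited j (k - 2)) x"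
    using ham_excited by blast
  show ?thesis
  proof (intro exI allI impI)
    fix u l j k assume u: "u \<in> eigenspace (landau_plus_potential B V) l"
    then have "u \<in> L2"
      by (auto simp: eigenspace_def landau_plus_potential_def form_operator_def landau_form_domain_def)
    define m where "m j k x = cnj (eval (excited j k) x) * u x" for j k x
    have int: "integrable lborel (m j k)" for j k
      unfolding m_def[abs_def] using \<open>u \<in> L2\<close> hermite_excited by (intro L2_mult_integrable hermite_L2)
    have M: "L2_inner (eval (excited j k)) u = integral\<^sup>L lborel (m j k)" for j k
      by (simp add: L2_inner_def m_def[abs_def])
    define e0 e1 e2 e3 where "e0 = complex_of_real (energy j k)" and "e1 = cnj c1 * of_nat (j * (j - 1))"
      and "e2 = cnj c2 * of_nat (j * k)" and "e3 = cnj c3 * of_nat (k * (k - 1))"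
    have "of_real l * integral\<^sup>L lborel (m j k) = L2_inner (eval (ham (excited j k))) u"
      unfolding M[symmetric] using eigenfunction_L2_inner[OF u hermite_excited] by simp
    also have "\<dots> = (\<integral>x. e0 * m j k x + e1 * m (j - 2) k x + e2 * m (j - 1) (k - 1) x + e3 * m j (k - 2) x \<partial>lborel)"
      unfolding L2_inner_def c
      by (intro Bochner_Integration.integral_cong) (auto simp: m_def e0_def e1_def e2_def e3_def algebra_simps)
    also have "\<dots> = e0 * integral\<^sup>L lborel (m j k) + e1 * integral\<^sup>L lborel (m (j - 2) k)
        + e2 * integral\<^sup>L lborel (m (j - 1) (k - 1)) + e3 * integral\<^sup>L lborel (m j (k - 2))"
      using int by (simp only: Bochner_Integration.integral_add Bochner_Integration.integrable_add
          integrable_mult_right integral_mult_right_zero)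
    finally have "of_real (l - energy j k) * integral\<^sup>L lborel (m j k) = e1 * integral\<^sup>L lborel (m (j - 2) k)
        + e2 * integral\<^sup>L lborel (m (j - 1) (k - 1)) + e3 * integral\<^sup>L lborel (m j (k - 2))"
      by (simp add: e0_def algebra_simps)
    then show "of_real (l - energy j k) * L2_inner (eval (excited j k)) u =
       cnj c1 * of_nat (j * (j - 1)) * L2_inner (eval (excited (j - 2) k)) u
     + cnj c2 * of_nat (j * k) * L2_inner (eval (excited (j - 1) (k - 1))) u
     + cnj c3 * of_nat (k * (k - 1)) * L2_inner (eval (excited j (k - 2))) u"
      unfolding M e1_def e2_def e3_def .
  qed
qed

text \<open>
Both coordinates are linear combinations of \<open>X\<close> and \<open>Y\<close>. An induction over the exponents of the
coordinates therefore leads from the states \<open>X^j * Y^k * G\<close> to all moments of \<open>cnj G * u\<close>, and this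
product has enough decay to be determined by its moments.
\<close>
lemma AE_eq_0_if_orthogonal_to_excited:
  assumes u: "u \<in> L2" and zero: "\<And>j k. L2_inner (eval (excited j k)) u = 0"
  shows "AE x in lborel. u x = 0"
proof -
  have [measurable]: "u \<in> borel_measurable borel" using u by (simp add: L2_def)
  define W where "W x = cnj (eval ground x) * u x" for x
  have [measurable]: "W \<in> borel_measurable borel" unfolding W_def[abs_def] by measurable
  define poly_state where "poly_state j k m n = Mul (Mul (Mul (Pow X j) (Pow Y k)) (Mul (Pow X1 m) (Pow X2 n))) ground" for j k m n
  have herm: "hermite (poly_state j k m n)" for j k m n
    unfolding poly_state_def by (intro hermite_Mul_ground) (simp add: X_def Y_def)
  define I where "I j k m n = L2_inner (eval (poly_state j k m n)) u" for j k m n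
  have int: "integrable lborel (\<lambda>x. cnj (eval (poly_state j k m n) x) * u x)" for j k m n
    using herm u by (intro L2_mult_integrable hermite_L2)
  have lin: "I j k m n = z * I j' k' m' n' + z' * I j'' k'' m'' n''"
    if "\<And>x. eval (poly_state j k m n) x = cnj z * eval (poly_state j' k' m' n') x + cnj z' * eval (poly_state j'' k'' m'' n'') x"
    for j k m n j' k' m' n' j'' k'' m'' n'' z z'
  proof -
    have "I j k m n = (\<integral>x. z * (cnj (eval (poly_state j' k' m' n') x) * u x) + z' * (cnj (eval (poly_state j'' k'' m'' n'') x) * u x) \<partial>lborel)"
      unfolding I_def L2_inner_def that by (intro Bochner_Integration.integral_cong) (auto simp: algebra_simps)
    also have "\<dots> = z * I j' k' m' n' + z' * I j'' k'' m'' n''"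
      unfolding I_def L2_inner_def using int
      by (simp only: Bochner_Integration.integral_add integrable_mult_right integral_mult_right_zero)
    finally show ?thesis .
  qed
  define \<delta> where "\<delta> = complex_of_real (\<alpha> - \<beta>)"
  have \<delta>: "\<delta> \<noteq> 0" using \<alpha>_minus_\<beta> by (simp add: \<delta>_def)
  have cnj_\<delta>: "cnj \<delta> = \<delta>" by (simp add: \<delta>_def)
  define \<gamma> where "\<gamma> = complex_of_real (\<alpha> - a)"
  have cnj_\<gamma>: "cnj \<gamma> = \<gamma>" by (simp add: \<gamma>_def)
  define \<eta> where "\<eta> = \<i> * complex_of_real b1"
  have \<eta>: "\<eta> \<noteq> 0" using b1_pos by (simp add: \<eta>_def)
  have x2: "of_real (snd x) = (eval X x - eval Y x) / \<delta>" for x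
  proof -
    have "eval X x - eval Y x = \<delta> * of_real (snd x)"
      by (simp add: X_def Y_def \<delta>_def algebra_simps)
    then show ?thesis using \<delta> by simp
  qed
  have x1: "of_real (fst x) = (eval X x - \<gamma> * of_real (snd x)) / \<eta>" for x
  proof -
    have "eval X x - \<gamma> * of_real (snd x) = \<eta> * of_real (fst x)"
      by (simp add: X_def \<gamma>_def \<eta>_def)
    then show ?thesis using \<eta> by simp
  qed
  (* factors of the second coordinate are traded for X and Y first, as step1 produces them *)
  have step2: "I j k m (Suc n) = (1 / \<delta>) * I (Suc j) k m n + (- 1 / \<delta>) * I j (Suc k) m n" for j k m n
  proof (rule lin)
    fix x
    have "eval (poly_state j k m (Suc n)) x = of_real (snd x) * eval (poly_state j k m n) x"
      by (simp add: poly_state_def mult_ac)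
    also have "\<dots> = (1 / \<delta>) * (eval X x * eval (poly_state j k m n) x) + (- 1 / \<delta>) * (eval Y x * eval (poly_state j k m n) x)"
      unfolding x2 by (simp add: diff_divide_distrib left_diff_distrib)
    finally show "eval (poly_state j k m (Suc n)) x
        = cnj (1 / \<delta>) * eval (poly_state (Suc j) k m n) x + cnj (- 1 / \<delta>) * eval (poly_state j (Suc k) m n) x"
      by (simp add: poly_state_def cnj_\<delta> mult_ac)
  qed
  have step1: "I j k (Suc m) n = cnj (1 / \<eta>) * I (Suc j) k m n + cnj (- \<gamma> / \<eta>) * I j k m (Suc n)" for j k m n
  proof (rule lin)
    fix x
    have "eval (poly_state j k (Suc m) n) x = of_real (fst x) * eval (poly_state j k m n) x"
      by (simp add: poly_state_def mult_ac)
    also have "\<dots> = (1 / \<eta>) * (eval X x * eval (poly_state j k m n) x) + (- \<gamma> / \<eta>) * (of_real (snd x) * eval (poly_state j k m n) x)"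
      unfolding x1[of x] by (simp add: diff_divide_distrib left_diff_distrib)
    finally show "eval (poly_state j k (Suc m) n) x
        = cnj (cnj (1 / \<eta>)) * eval (poly_state (Suc j) k m n) x + cnj (cnj (- \<gamma> / \<eta>)) * eval (poly_state j k m (Suc n)) x"
      unfolding complex_cnj_cnj by (simp add: poly_state_def mult_ac)
  qed
  have base: "I j k 0 n = 0" for j k n
  proof (induction n arbitrary: j k)
    case 0
    have "eval (poly_state j k 0 0) = eval (excited j k)" by (simp add: poly_state_def excited_def fun_eq_iff)
    then show ?case using zero by (simp add: I_def)
  next
    case (Suc n)
    then show ?case unfolding step2 by simp
  qed
  have I0: "I j k m n = 0" for j k m n
  proof (induction m arbitrary: j k n)
    case 0
    show ?case by (rule base)
  next
    case (Suc m)
    then show ?case unfolding step1 by simp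
  qed
  have "AE x in lborel. W x = 0"
  proof (rule AE_eq_0_if_moments_eq_0_plane)
    show "integrable lborel (\<lambda>x. complex_of_real (exp (real c * (\<bar>fst x\<bar> + \<bar>snd x\<bar>))) * W x)" for c
      using L2_mult_integrable[OF gaussian_growth_L2[of "real c"] u]
      by (simp add: W_def mult_ac)
    show "(\<integral>x. complex_of_real (fst x ^ m * snd x ^ n) * W x \<partial>lborel) = 0" for m n
      using I0[of 0 0 m n] by (simp add: I_def L2_inner_def poly_state_def W_def mult_ac)
  qed simp
  then show ?thesis
    by eventually_elim (simp add: W_def ground_def)
qed

lemma eigenspace_L2: "u \<in> eigenspace (landau_plus_potential B V) l \<Longrightarrow> u \<in> L2"
  by (auto simp: eigenspace_def landau_plus_potential_def form_operator_def landau_form_domain_def)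

text \<open>
The recursion is linear and so passes to linear combinations of eigenfunctions. By induction on the
degree \<open>j + k\<close>, all coefficients vanish once those do for which the factor \<open>l - energy j k\<close>
is zero. The statement speaks about combinations so that it yields both the bound on the dimension and
the location of the eigenvalues.
\<close>
lemma combination_eq_0:
  fixes n :: nat
  assumes u: "\<And>i. i < n \<Longrightarrow> u i \<in> eigenspace (landau_plus_potential B V) l"
    and zero: "\<And>j k. energy j k = l \<Longrightarrow> (\<Sum>i<n. c i * L2_inner (eval (excited j k)) (u i)) = 0"
  shows "AE x in lborel. (\<Sum>i<n. c i * u i x) = 0"
proof -
  obtain c1 c2 c3 where rec: "\<And>v j k. v \<in> eigenspace (landau_plus_potential B V) l \<Longrightarrow>
     of_real (l - energy j k) * L2_inner (eval (excited j k)) v =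
       c1 * of_nat (j * (j - 1)) * L2_inner (eval (excited (j - 2) k)) v
     + c2 * of_nat (j * k) * L2_inner (eval (excited (j - 1) (k - 1))) v
     + c3 * of_nat (k * (k - 1)) * L2_inner (eval (excited j (k - 2))) v"
    using coefficient_recursion by metis
  define M where "M j k = (\<Sum>i<n. c i * L2_inner (eval (excited j k)) (u i))" for j k
  have recM: "of_real (l - energy j k) * M j k = c1 * of_nat (j * (j - 1)) * M (j - 2) k
     + c2 * of_nat (j * k) * M (j - 1) (k - 1) + c3 * of_nat (k * (k - 1)) * M j (k - 2)" for j k
  proof -
    have "of_real (l - energy j k) * M j k = (\<Sum>i<n. c i * (of_real (l - energy j k) * L2_inner (eval (excited j k)) (u i)))"
      by (simp only: M_def sum_distrib_left mult_ac)
    also have "\<dots> = (\<Sum>i<n. c i * (c1 * of_nat (j * (j - 1)) * L2_inner (eval (excited (j - 2) k)) (u i)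
       + c2 * of_nat (j * k) * L2_inner (eval (excited (j - 1) (k - 1))) (u i)
       + c3 * of_nat (k * (k - 1)) * L2_inner (eval (excited j (k - 2))) (u i)))"
      by (rule sum.cong) (auto simp only: rec[OF u] lessThan_iff)
    also have "\<dots> = c1 * of_nat (j * (j - 1)) * M (j - 2) k
     + c2 * of_nat (j * k) * M (j - 1) (k - 1) + c3 * of_nat (k * (k - 1)) * M j (k - 2)"
      by (simp only: M_def sum_distrib_left distrib_left sum.distrib mult_ac)
    finally show ?thesis .
  qed
  have M0: "M j k = 0" for j k
  proof (induction "j + k" arbitrary: j k rule: less_induct)
    case less
    show ?case
    proof (cases "energy j k = l")
      case True
      then show ?thesis using zero by (simp add: M_def)
    next
      case False
      have "of_nat (j * (j - 1)) * M (j - 2) k = 0"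
        by (cases "j \<ge> 2") (use less[of "j - 2" k] in \<open>auto simp: not_le less_2_cases_iff\<close>)
      moreover have "of_nat (j * k) * M (j - 1) (k - 1) = 0"
        by (cases "j = 0 \<or> k = 0") (use less[of "j - 1" "k - 1"] in auto)
      moreover have "of_nat (k * (k - 1)) * M j (k - 2) = 0"
        by (cases "k \<ge> 2") (use less[of j "k - 2"] in \<open>auto simp: not_le less_2_cases_iff\<close>)
      ultimately have "of_real (l - energy j k) * M j k = 0"
        unfolding recM mult.assoc by (simp only: mult_zero_right add_0_right)
      then show ?thesis using False by simp
    qed
  qed
  have L2u: "u i \<in> L2" if "i < n" for i
    using u[OF that] by (rule eigenspace_L2)
  have L2sum: "(\<lambda>x. \<Sum>i<m. c i * u i x) \<in> L2" if "m \<le> n" for m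
    using that
  proof (induction m)
    case 0
    show ?case by (simp add: L2_def)
  next
    case (Suc m)
    then show ?case using L2_lincomb[OF Suc.IH L2u[of m], of 1 "c m"] by simp
  qed
  show ?thesis
  proof (rule AE_eq_0_if_orthogonal_to_excited[OF L2sum[OF order_refl]])
    fix j k
    have "L2_inner (eval (excited j k)) (\<lambda>x. \<Sum>i<n. c i * u i x) = (\<integral>x. (\<Sum>i<n. c i * (cnj (eval (excited j k) x) * u i x)) \<partial>lborel)"
      unfolding L2_inner_def by (simp add: sum_distrib_left mult_ac)
    also have "\<dots> = (\<Sum>i<n. \<integral>x. c i * (cnj (eval (excited j k) x) * u i x) \<partial>lborel)"
      by (intro Bochner_Integration.integral_sum integrable_mult_right L2_mult_integrable hermite_L2 hermite_excited L2u) simp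
    also have "\<dots> = M j k"
      by (simp add: M_def L2_inner_def)
    finally show "L2_inner (eval (excited j k)) (\<lambda>x. \<Sum>i<n. c i * u i x) = 0" using M0 by simp
  qed
qed

lemma energy_le_bounded: "\<exists>N. \<forall>j k. energy j k \<le> l \<longrightarrow> j \<le> N \<and> k \<le> N"
proof -
  obtain N :: nat where N: "l + \<mu> \<le> real N * min \<alpha> \<beta>"
    using ex_less_of_nat_mult[of "min \<alpha> \<beta>" "l + \<mu>"] \<alpha>_ge_B B_pos \<beta>_pos by (auto intro: less_imp_le)
  have "j \<le> N \<and> k \<le> N" if "energy j k \<le> l" for j k
  proof -
    have pos: "\<alpha> > 0" "\<beta> > 0" using \<alpha>_ge_B B_pos \<beta>_pos by linarith+
    have "real j * \<alpha> + real k * \<beta> \<le> energy j k + \<mu>"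
    proof -
      have "0 \<le> (real j + 1) * \<alpha> + (real k + 1) * \<beta>" using pos by simp
      then show ?thesis by (simp add: energy_def algebra_simps)
    qed
    then have s: "real j * \<alpha> + real k * \<beta> \<le> real N * min \<alpha> \<beta>" using that N by linarith
    have "0 \<le> real j * \<alpha>" "0 \<le> real k * \<beta>" using pos by simp_all
    then have "real j * \<alpha> \<le> real N * \<alpha>" "real k * \<beta> \<le> real N * \<beta>"
      using s mult_left_mono[of "min \<alpha> \<beta>" \<alpha> "real N"] mult_left_mono[of "min \<alpha> \<beta>" \<beta> "real N"] by auto
    then show ?thesis using pos by simp
  qed
  then show ?thesis by blast
qed

lemma finite_energy_le: "finite {(j, k). energy j k \<le> l}"
proof -
  obtain N where "\<forall>j k. energy j k \<le> l \<longrightarrow> j \<le> N \<and> k \<le> N"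
    using energy_le_bounded by blast
  then have "{(j, k). energy j k \<le> l} \<subseteq> {..N} \<times> {..N}" by auto
  then show ?thesis by (rule finite_subset) simp
qed

definition level :: "real \<Rightarrow> (nat \<times> nat) set" where
  "level l = {(j, k). energy j k = l}"

lemma finite_level: "finite (level l)"
  by (rule finite_subset[OF _ finite_energy_le[of l]]) (auto simp: level_def)

text \<open>
Otherwise the homogeneous system that makes all coefficients on the level vanish has fewer equations
than unknowns, and a non-trivial solution contradicts independence.
\<close>
lemma independent_eigenfunctions_le:
  assumes u: "\<And>i. i < n \<Longrightarrow> u i \<in> eigenspace (landau_plus_potential B V) l"
    and ind: "L2_independent n u"
  shows "n \<le> card (level l)"
proof (rule ccontr)
  assume "\<not> n \<le> card (level l)"
  then have "card (level l) < card {..<n}" by simp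
  from homogeneous_system_nontrivial_solution[OF finite_level finite_lessThan this,
      of "\<lambda>e i. L2_inner (eval (excited (fst e) (snd e))) (u i)"]
  obtain c where c: "\<exists>i\<in>{..<n}. c i \<noteq> 0"
    "\<forall>e\<in>level l. (\<Sum>i<n. c i * L2_inner (eval (excited (fst e) (snd e))) (u i)) = 0"
    by blast
  have "AE x in lborel. (\<Sum>i<n. c i * u i x) = 0"
  proof (rule combination_eq_0[OF u])
    fix j k assume "energy j k = l"
    then have "(j, k) \<in> level l" by (simp add: level_def)
    from bspec[OF c(2) this] show "(\<Sum>i<n. c i * L2_inner (eval (excited j k)) (u i)) = 0" by simp
  qed
  then show False using ind c(1) by (auto simp: L2_independent_def)
qed

lemma L2_dim_eigenspace_le:
  "L2_dim (eigenspace (landau_plus_potential B V) l) \<le> enat (card (level l))"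
  unfolding L2_dim_def using independent_eigenfunctions_le by (intro SUP_least) auto

lemma eigenvalue_level_nonempty:
  assumes "eigenvalue (landau_plus_potential B V) l"
  shows "level l \<noteq> {}"
proof
  assume empty: "level l = {}"
  obtain u where u: "u \<in> eigenspace (landau_plus_potential B V) l" "\<not> (AE x in lborel. u x = 0)"
    using assms by (auto simp: eigenvalue_def)
  have "AE x in lborel. (\<Sum>i<1::nat. 1 * u x) = 0"
    using u(1) empty by (intro combination_eq_0[where u = "\<lambda>_. u"]) (auto simp: level_def)
  then show False using u(2) by simp
qed

text \<open>
Every eigenvalue is one of the energies, and its multiplicity is at most the size of its level; the
levels are disjoint.
\<close>
lemma trace_negative_part_le_sum:
  "trace_negative_part (landau_plus_potential B V)
    \<le> ennreal (\<Sum>(j, k)\<in>{(j, k). energy j k < 0}. - energy j k)"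
proof -
  let ?A = "landau_plus_potential B V"
  let ?I = "{(j, k). energy j k < 0}"
  let ?E = "{l. l < 0 \<and> eigenvalue ?A l}"
  have fin: "finite ?I" by (rule finite_subset[OF _ finite_energy_le[of 0]]) auto
  have sub: "?E \<subseteq> (\<lambda>(j, k). energy j k) ` ?I"
  proof
    fix l assume l: "l \<in> ?E"
    then obtain j k where "energy j k = l" using eigenvalue_level_nonempty[of l] by (auto simp: level_def)
    then show "l \<in> (\<lambda>(j, k). energy j k) ` ?I" using l by (auto intro!: image_eqI[of _ _ "(j, k)"])
  qed
  then have finE: "finite ?E" using fin by (rule finite_surj[rotated])
  have "trace_negative_part ?A = (\<Sum>l\<in>?E. ennreal \<bar>l\<bar> * ennreal_of_enat (L2_dim (eigenspace ?A l)))"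
    unfolding trace_negative_part_def using finE by (rule infsum_finite)
  also have "\<dots> \<le> (\<Sum>l\<in>?E. ennreal \<bar>l\<bar> * ennreal_of_enat (enat (card (level l))))"
    by (intro sum_mono mult_left_mono ennreal_of_enat_le_iff[THEN iffD2] L2_dim_eigenspace_le) simp
  also have "\<dots> = (\<Sum>l\<in>?E. ennreal (\<Sum>(j, k)\<in>level l. - energy j k))"
  proof (rule sum.cong)
    fix l assume "l \<in> ?E"
    then have "(\<Sum>(j, k)\<in>level l. - energy j k) = (\<Sum>_\<in>level l. \<bar>l\<bar>)"
      by (intro sum.cong) (auto simp: level_def)
    then show "ennreal \<bar>l\<bar> * ennreal_of_enat (enat (card (level l))) = ennreal (\<Sum>(j, k)\<in>level l. - energy j k)"
      by (simp add: ennreal_mult ennreal_of_nat_eq_real_of_nat mult.commute)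
  qed simp
  also have "\<dots> = ennreal (\<Sum>l\<in>?E. \<Sum>(j, k)\<in>level l. - energy j k)"
    by (intro sum_ennreal sum_nonneg) (auto simp: level_def)
  also have "(\<Sum>l\<in>?E. \<Sum>(j, k)\<in>level l. - energy j k) = (\<Sum>(j, k)\<in>(\<Union>l\<in>?E. level l). - energy j k)"
    using finE finite_level by (intro sum.UNION_disjoint[symmetric]) (auto simp: level_def)
  also have "ennreal \<dots> \<le> ennreal (\<Sum>(j, k)\<in>?I. - energy j k)"
    using fin by (intro ennreal_leI sum_mono2) (auto simp: level_def)
  finally show ?thesis .
qed

lemma trace_bound:
  assumes "\<mu> > 0"
  shows "trace_negative_part (landau_plus_potential B V) \<le> ennreal (B / (2 * pi)) *
      (\<Sum>m. \<integral>\<^sup>+x. ennreal (negative_part ((2 * real m + 1) * B + V x)) \<partial>lborel)"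
proof -
  let ?I = "{(j, k). energy j k < 0}"
  obtain J0 :: nat where J0: "\<mu> \<le> real J0 * B"
    using ex_less_of_nat_mult[OF B_pos, of \<mu>] by (auto intro: less_imp_le)
  obtain N where N: "\<forall>j k. energy j k \<le> 0 \<longrightarrow> j \<le> N \<and> k \<le> N"
    using energy_le_bounded by blast
  define J where "J = Suc (max J0 N)"
  have J: "\<mu> \<le> (2 * real J + 1) * B"
  proof -
    have "real J0 * B \<le> (2 * real J + 1) * B" using B_pos by (intro mult_right_mono) (auto simp: J_def)
    then show ?thesis using J0 by linarith
  qed
  have "(\<Sum>(j, k)\<in>?I. - energy j k) \<le> (\<Sum>(j, k)\<in>{..<J} \<times> {..<J}. max 0 (- energy j k))"
  proof -
    have "(\<Sum>(j, k)\<in>?I. - energy j k) = (\<Sum>(j, k)\<in>?I. max 0 (- energy j k))"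
      by (intro sum.cong) auto
    also have "\<dots> \<le> (\<Sum>(j, k)\<in>{..<J} \<times> {..<J}. max 0 (- energy j k))"
    proof (rule sum_mono2)
      show "?I \<subseteq> {..<J} \<times> {..<J}"
      proof clarify
        fix j k assume "energy j k < 0"
        then have "j \<le> N" "k \<le> N" using N by (auto dest: less_imp_le)
        then show "j \<in> {..<J} \<and> k \<in> {..<J}" by (auto simp: J_def less_Suc_eq_le)
      qed
    qed auto
    finally show ?thesis .
  qed
  also have "\<dots> = (\<Sum>j<J. \<Sum>k<J. max 0 (\<mu> - (2 * real j + 1) * \<alpha> - (2 * real k + 1) * \<beta>))"
  proof -
    have "- energy j k = \<mu> - (2 * real j + 1) * \<alpha> - (2 * real k + 1) * \<beta>" for j k
      by (simp add: energy_def)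
    then show ?thesis by (simp only: sum.cartesian_product)
  qed
  finally have "ennreal (\<Sum>(j, k)\<in>?I. - energy j k)
      \<le> ennreal (\<Sum>j<J. \<Sum>k<J. max 0 (\<mu> - (2 * real j + 1) * \<alpha> - (2 * real k + 1) * \<beta>))"
    by (rule ennreal_leI)
  also have "\<dots> \<le> ennreal (B / (2 * pi)) *
      (\<Sum>m. \<integral>\<^sup>+x. ennreal (negative_part ((2 * real m + 1) * B + V x)) \<partial>lborel)"
    unfolding V_def
    by (intro oscillator_sum_le B_pos \<beta>_pos assms \<omega>\<^sub>1_pos \<omega>\<^sub>2_pos \<alpha>_ge_B \<alpha>_times_\<beta> J)
  finally show ?thesis using trace_negative_part_le_sum by (rule order_trans[rotated])
qed

end

section \<open>The trace inequality\<close>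

theorem theorem2:
  fixes B \<omega>\<^sub>1 \<omega>\<^sub>2 \<mu> :: real and V :: "real \<times> real \<Rightarrow> real"
  assumes "B > 0" and "\<omega>\<^sub>1 > 0" and "\<omega>\<^sub>2 > 0" and "\<mu> > 0"
    and "V = (\<lambda>x. \<omega>\<^sub>1\<^sup>2 * (fst x)\<^sup>2 + \<omega>\<^sub>2\<^sup>2 * (snd x)\<^sup>2 - \<mu>)"
  shows "trace_negative_part (landau_plus_potential B V)
    \<le> ennreal (B / (2 * pi)) *
      (\<Sum>m. \<integral>\<^sup>+x. ennreal (negative_part ((2 * real m + 1) * B + V x)) \<partial>lborel)"
proof -
  interpret landau_oscillator B \<omega>\<^sub>1 \<omega>\<^sub>2 \<mu>
    using assms by unfold_locales
  show ?thesis
    using trace_bound[OF assms(4)] by (simp only: assms(5) V_def)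
qed

end
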